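(* Let $r,n,k\in\mathbb N$ with $r,n\ge 1$ and $k\ge 2$. The monoid $\operatorname{tot} nM_{k,r}$ is finitely presented.
   Context: $X_r=\{0,\dots,r-1\}$, $A_k=\{0,\dots,k-1\}$, $A_k^*$ is the set of finite words and $A_k^\omega$ the set of infinite words over $A_k$. Put $nT_{k,r}=X_r\times (A_k^* )^n$, $\mathfrak C_{n,k}=(A_k^\omega)^n$, $\mathfrak C_{n,k,r}=X_r\times\mathfrak C_{n,k}$ (product topology). For $w=(m,s)\in nT_{k,r}$ and $t\in (A_k^* )^n\cup\mathfrak C_{n,k}$, $w\cdot t=(m,st)$, where $st$ is coordinatewise concatenation. For $u,v\in nT_{k,r}$, $u\le v$ means $v=u\cdot t$ for some $t\in(A_k^* )^n$. The cone under $w\in nT_{k,r}$ is $w\mathfrak C_{n,k}=\{w\cdot t: t\in\mathfrak C_{n,k}\}$. For finite $S\subseteq nT_{k,r}$, $\operatorname{Leaves}(S)$ is the set of $\le$-maximal elements of $S$. A pseudotree is a finite subset $T\subseteq nT_{k,r}$ that is downwards closed for $\le$ and such that the cones under the elements of $\operatorname{Leaves}(T)$ partition $\mathfrak C_{n,k,r}$. A pseudotree pair is a pair $(D,h)$ with $D$ a pseudotree and $h:\operatorname{Leaves}(D)\to nT_{k,r}$ any function. It represents the map $f:\mathfrak C_{n,k,r}\to\mathfrak C_{n,k,r}$ with $(d\cdot w)f=((d)h)\cdot w$ for all $d\in\operatorname{Leaves}(D)$, $w\in\mathfrak C_{n,k}$ (functions are written on the right). $\operatorname{tot} nM_{k,r}$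 is the monoid, under composition of maps (from left to right), of all maps represented by pseudotree pairs. A monoid is finitely presented if it is isomorphic to the quotient of a finitely generated free monoid by a congruence generated by finitely many pairs. *)

theory Defs
  imports "HOL-Algebra.Group" "HOL-Library.Stream" "HOL-Library.Disjoint_Sets" "HOL-Library.FuncSet"
begin

section \<open>Words, cones and pseudotrees\<close>

text \<open>
  The alphabet with \<open>k\<close> letters is \<open>{..<k}\<close>; \<open>lists\<close> and \<open>streams\<close> give the finite and the
  infinite words over it.  An \<open>n\<close>-tuple is an extensional function on \<open>{..<n}\<close>, so that equality
  of tuples is equality of functions.
\<close>

definition fin_words :: "nat \<Rightarrow> nat \<Rightarrow> (nat \<Rightarrow> nat list) set" where
  "fin_words n k = {..<n} \<rightarrow>\<^sub>E lists {..<k}"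

definition inf_words :: "nat \<Rightarrow> nat \<Rightarrow> (nat \<Rightarrow> nat stream) set" where
  "inf_words n k = {..<n} \<rightarrow>\<^sub>E streams {..<k}"

definition nT :: "nat \<Rightarrow> nat \<Rightarrow> nat \<Rightarrow> (nat \<times> (nat \<Rightarrow> nat list)) set" where
  "nT n k r = {..<r} \<times> fin_words n k"

definition Cantor :: "nat \<Rightarrow> nat \<Rightarrow> nat \<Rightarrow> (nat \<times> (nat \<Rightarrow> nat stream)) set" where
  "Cantor n k r = {..<r} \<times> inf_words n k"

definition dot_fin ::
  "nat \<Rightarrow> nat \<times> (nat \<Rightarrow> nat list) \<Rightarrow> (nat \<Rightarrow> nat list) \<Rightarrow> nat \<times> (nat \<Rightarrow> nat list)" where
  "dot_fin n w t = (fst w, \<lambda>i\<in>{..<n}. snd w i @ t i)"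

definition dot_inf ::
  "nat \<Rightarrow> nat \<times> (nat \<Rightarrow> nat list) \<Rightarrow> (nat \<Rightarrow> nat stream) \<Rightarrow> nat \<times> (nat \<Rightarrow> nat stream)" where
  "dot_inf n w t = (fst w, \<lambda>i\<in>{..<n}. snd w i @- t i)"

definition nT_le ::
  "nat \<Rightarrow> nat \<Rightarrow> nat \<times> (nat \<Rightarrow> nat list) \<Rightarrow> nat \<times> (nat \<Rightarrow> nat list) \<Rightarrow> bool" where
  "nT_le n k u v \<longleftrightarrow> (\<exists>t\<in>fin_words n k. v = dot_fin n u t)"

definition cone ::
  "nat \<Rightarrow> nat \<Rightarrow> nat \<times> (nat \<Rightarrow> nat list) \<Rightarrow> (nat \<times> (nat \<Rightarrow> nat stream)) set" where
  "cone n k w = dot_inf n w ` inf_words n k"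

definition Leaves ::
  "nat \<Rightarrow> nat \<Rightarrow> (nat \<times> (nat \<Rightarrow> nat list)) set \<Rightarrow> (nat \<times> (nat \<Rightarrow> nat list)) set" where
  "Leaves n k S = {v \<in> S. \<forall>u\<in>S. nT_le n k v u \<longrightarrow> u = v}"

text \<open>
  For \<open>n \<ge> 1\<close> and \<open>k \<ge> 2\<close> distinct elements of \<open>nT n k r\<close> have distinct cones, so it
  makes no difference that the cones are collected into a set rather than an indexed family.
\<close>

definition pseudotree ::
  "nat \<Rightarrow> nat \<Rightarrow> nat \<Rightarrow> (nat \<times> (nat \<Rightarrow> nat list)) set \<Rightarrow> bool" where
  "pseudotree n k r T \<longleftrightarrow>
     finite T \<and> T \<subseteq> nT n k r \<and>
     (\<forall>v\<in>T. \<forall>u\<in>nT n k r. nT_le n k u v \<longrightarrow> u \<in> T) \<and>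
     partition_on (Cantor n k r) (cone n k ` Leaves n k T)"

section \<open>The monoid of maps represented by pseudotree pairs\<close>

definition pseudotree_pair ::
  "nat \<Rightarrow> nat \<Rightarrow> nat \<Rightarrow> (nat \<times> (nat \<Rightarrow> nat list)) set \<Rightarrow>
     (nat \<times> (nat \<Rightarrow> nat list) \<Rightarrow> nat \<times> (nat \<Rightarrow> nat list)) \<Rightarrow> bool" where
  "pseudotree_pair n k r D h \<longleftrightarrow> pseudotree n k r D \<and> h \<in> Leaves n k D \<rightarrow> nT n k r"

definition represents ::
  "nat \<Rightarrow> nat \<Rightarrow> nat \<Rightarrow> (nat \<times> (nat \<Rightarrow> nat list)) set \<Rightarrow>
     (nat \<times> (nat \<Rightarrow> nat list) \<Rightarrow> nat \<times> (nat \<Rightarrow> nat list)) \<Rightarrow>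
     (nat \<times> (nat \<Rightarrow> nat stream) \<Rightarrow> nat \<times> (nat \<Rightarrow> nat stream)) \<Rightarrow> bool" where
  "represents n k r D h f \<longleftrightarrow>
     f \<in> Cantor n k r \<rightarrow>\<^sub>E Cantor n k r \<and>
     (\<forall>d\<in>Leaves n k D. \<forall>w\<in>inf_words n k. f (dot_inf n d w) = dot_inf n (h d) w)"

text \<open>Products are read from left to right: in \<open>f \<otimes> g\<close> the map \<open>f\<close> is applied first.\<close>

definition totM ::
  "nat \<Rightarrow> nat \<Rightarrow> nat \<Rightarrow> (nat \<times> (nat \<Rightarrow> nat stream) \<Rightarrow> nat \<times> (nat \<Rightarrow> nat stream)) monoid" where
  "totM n k r =
     \<lparr>carrier = {f. \<exists>D h. pseudotree_pair n k r D h \<and> represents n k r D h f},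
      mult = (\<lambda>f g. compose (Cantor n k r) g f),
      one = (\<lambda>x\<in>Cantor n k r. x)\<rparr>"

section \<open>Finitely presented monoids\<close>

definition free_monoid :: "'a set \<Rightarrow> 'a list monoid" where
  "free_monoid A = \<lparr>carrier = lists A, mult = (@), one = []\<rparr>"

definition monoid_congruence :: "('a, 'b) monoid_scheme \<Rightarrow> 'a rel \<Rightarrow> bool" where
  "monoid_congruence M E \<longleftrightarrow>
     equiv (carrier M) E \<and>
     (\<forall>(a, b)\<in>E. \<forall>(c, d)\<in>E. (a \<otimes>\<^bsub>M\<^esub> c, b \<otimes>\<^bsub>M\<^esub> d) \<in> E)"

definition generated_congruence :: "('a, 'b) monoid_scheme \<Rightarrow> 'a rel \<Rightarrow> 'a rel" where
  "generated_congruence M R = \<Inter>{E. monoid_congruence M E \<and> R \<subseteq> E}"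

definition quotient_monoid :: "('a, 'b) monoid_scheme \<Rightarrow> 'a rel \<Rightarrow> 'a set monoid" where
  "quotient_monoid M E =
     \<lparr>carrier = carrier M // E,
      mult = (\<lambda>X Y. \<Union>x\<in>X. \<Union>y\<in>Y. E `` {x \<otimes>\<^bsub>M\<^esub> y}),
      one = E `` {\<one>\<^bsub>M\<^esub>}\<rparr>"

text \<open>
  Finite alphabets may be taken inside \<open>nat\<close>.  The relation \<open>\<cong>\<close> only mentions multiplication;
  as both sides are monoids, a multiplicative bijection also preserves the unit.
\<close>

definition finitely_presented_monoid :: "('a, 'b) monoid_scheme \<Rightarrow> bool" where
  "finitely_presented_monoid M \<longleftrightarrow>
     monoid M \<and>
     (\<exists>(A :: nat set) R. finite A \<and> finite R \<and> R \<subseteq> lists A \<times> lists A \<and>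
        M \<cong> quotient_monoid (free_monoid A) (generated_congruence (free_monoid A) R))"

end

theory Submission
  imports Defs
begin

text \<open>
  A map belongs to \<open>totM n k r\<close> iff for some \<open>N\<close> it replaces a prefix on every cone whose words
  all have length \<open>N\<close>.  Let \<open>\<alpha>\<^sub>a\<close> (\<open>a < K\<close>) be the maps that put a fixed tuple of words of length
  \<open>r + 1\<close> in front of every point.  Every family \<open>(f\<^sub>a)\<close> in the monoid is joined by a unique \<open>h\<close> with
  \<open>\<alpha>\<^sub>a h = f\<^sub>a\<close>, so \<open>\<phi>\<^sub>a(y)\<close>, acting as \<open>y\<close> on the \<open>a\<close>-th piece and fixing the others, is an
  endomorphism.  As in Thompson's group \<open>F\<close>, there is a unit \<open>g\<close> with
  \<open>\<phi>\<^sub>0(\<phi>\<^sub>0(y)) = g\<^sup>-\<^sup>1 \<phi>\<^sub>0(y) g\<close>; hence finitely many relators suffice for \<open>\<phi>\<^sub>0\<close>, and by conjugation every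
  \<open>\<phi>\<^sub>a\<close>, to act on the presented monoid \<open>P\<close>.  With \<open>\<mu>\<close> the join of identities, finitely many more
  relators give \<open>p = (\<Prod>\<^sub>a \<phi>\<^sub>a(\<alpha>\<^sub>a p)) \<mu>\<close> in \<open>P\<close>, so that the \<open>\<alpha>\<^sub>a\<close> are jointly left cancellable in \<open>P\<close>.
  Multiplying any word on the left by the maps onto sufficiently small cones turns it into a
  normal form that its value determines; by cancellation, words with equal values are equal in \<open>P\<close>.
\<close>

text \<open>For r > 1 one family of prefix maps cannot do everything. The \<alpha> a keep the copy
  index, so every family has a join along them, but a long product of them followed by f is a prefix
  replacement that still varies with the copy. The maps onto single cones forget the copy index:
  long products of them turn any f into one prefix replacement, but only families that ignore the
  copy can be joined along them. The pair \<theta>, \<theta>' links the two: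
  \<open>\<theta>' \<otimes> \<theta> = \<one>\<close>, and every
  \<open>\<alpha> a \<otimes> \<theta>\<close> is a map onto a cone of depth 1. Hence left
  cancellation passes from the \<alpha> a to the cone maps. A generator is absorbed by relators only
  behind a fixed number of cone maps of depth 1. While a word is read letter by letter, this prefix
  has already merged into a normal form. It is regained by factoring the product anew with short
  cone maps last. The two factorisations are compared by value only; they agree in P because each
  reduces there to a normal form and values determine normal forms.\<close>

declare in_listsI [rule del] in_listsD [rule del]

section \<open>Congruences on words\<close>

text \<open>Letters are not restricted to a generating set, which spares membership conditions in
  every rule. As long as R relates words over S, a word over S is congruent only to words over
  S.\<close>

inductive word_cong :: "('a list \<times> 'a list) set \<Rightarrow> 'a list \<Rightarrow> 'a list \<Rightarrow> bool" for R where
  base: "(u, v) \<in> R \<Longrightarrow> word_cong R u v"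
| refl: "word_cong R u u"
| sym: "word_cong R u v \<Longrightarrow> word_cong R v u"
| trans: "word_cong R u v \<Longrightarrow> word_cong R v w \<Longrightarrow> word_cong R u w"
| append: "word_cong R u u' \<Longrightarrow> word_cong R v v' \<Longrightarrow> word_cong R (u @ v) (u' @ v')"

declare word_cong.trans [trans]

lemma word_cong_mono: "word_cong R u v \<Longrightarrow> R \<subseteq> R' \<Longrightarrow> word_cong R' u v"
  by (induction rule: word_cong.induct) (auto intro: word_cong.intros)

lemma word_cong_left: "word_cong R v v' \<Longrightarrow> word_cong R (u @ v) (u @ v')"
  by (simp add: word_cong.append word_cong.refl)

lemma word_cong_right: "word_cong R u u' \<Longrightarrow> word_cong R (u @ v) (u' @ v)"
  by (simp add: word_cong.append word_cong.refl)

lemma word_cong_mid: "word_cong R u u' \<Longrightarrow> word_cong R (x @ u @ y) (x @ u' @ y)"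
  by (simp add: word_cong.append word_cong.refl)

lemma word_cong_commute_append:
  assumes "word_cong R (u @ w) (w @ u)" "word_cong R (v @ w) (w @ v)"
  shows "word_cong R ((u @ v) @ w) (w @ (u @ v))"
proof -
  have "word_cong R (u @ (v @ w)) (u @ (w @ v))"
    by (rule word_cong_left[OF assms(2)])
  also have "u @ (w @ v) = (u @ w) @ v" by simp
  also have "word_cong R ((u @ w) @ v) ((w @ u) @ v)"
    by (rule word_cong_right[OF assms(1)])
  finally show ?thesis by simp
qed

lemma word_cong_commute_lists:
  assumes "\<And>x y. x \<in> set u \<Longrightarrow> y \<in> set v \<Longrightarrow> word_cong R ([x] @ [y]) ([y] @ [x])"
  shows "word_cong R (u @ v) (v @ u)"
  using assms
proof (induction u)
  case Nil
  show ?case by (simp add: word_cong.refl)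
next
  case (Cons x u)
  have "word_cong R (v @ [x]) ([x] @ v)" using Cons.prems
  proof (induction v)
    case Nil
    show ?case by (simp add: word_cong.refl)
  next
    case (Cons y v)
    have "word_cong R (([y] @ v) @ [x]) ([x] @ ([y] @ v))"
      by (rule word_cong_commute_append) (use Cons in \<open>auto intro: word_cong.sym\<close>)
    then show ?case by simp
  qed
  then have "word_cong R (([x] @ u) @ v) (v @ ([x] @ u))"
    by (intro word_cong_commute_append) (use Cons in \<open>auto intro: word_cong.sym\<close>)
  then show ?case by simp
qed

lemma word_cong_commute_concat:
  assumes "\<And>i. i \<in> set is \<Longrightarrow> word_cong R (u @ U i) (U i @ u)"
  shows "word_cong R (u @ concat (map U is)) (concat (map U is) @ u)"
  using assms
proof (induction "is")
  case Nil
  show ?case by (simp add: word_cong.refl)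
next
  case (Cons i "is")
  have "word_cong R ((U i @ concat (map U is)) @ u) (u @ (U i @ concat (map U is)))"
    by (rule word_cong_commute_append) (use Cons in \<open>auto intro: word_cong.sym\<close>)
  then show ?case by (simp add: word_cong.sym)
qed

text \<open>Each \<open>V i\<close> is moved to the right past the \<open>U j\<close> of later
  indices only, so factors with the same index need not commute.\<close>

lemma word_cong_concat_append:
  assumes "distinct is"
    and "\<And>i j. i \<in> set is \<Longrightarrow> j \<in> set is \<Longrightarrow> i \<noteq> j \<Longrightarrow> word_cong R (V i @ U j) (U j @ V i)"
  shows "word_cong R (concat (map (\<lambda>i. U i @ V i) is)) (concat (map U is) @ concat (map V is))"
  using assms
proof (induction "is")
  case Nil
  show ?case by (simp add: word_cong.refl)
next
  case (Cons i "is")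
  let ?U = "concat (map U is)" and ?V = "concat (map V is)"
  have "word_cong R ((U i @ V i) @ concat (map (\<lambda>i. U i @ V i) is)) ((U i @ V i) @ (?U @ ?V))"
    using Cons by (intro word_cong_left) auto
  also have "(U i @ V i) @ (?U @ ?V) = U i @ (V i @ ?U) @ ?V" by simp
  also have "word_cong R \<dots> (U i @ (?U @ V i) @ ?V)"
    using Cons.prems by (intro word_cong_mid word_cong_commute_concat) auto
  finally show ?case by simp
qed

lemma word_cong_concat_map:
  assumes "\<And>i. i \<in> set is \<Longrightarrow> word_cong R (U i) (V i)"
  shows "word_cong R (concat (map U is)) (concat (map V is))"
  using assms by (induction "is") (auto intro: word_cong.intros)

section \<open>Evaluation of words and a criterion for finite presentability\<close>

definition word_prod :: "('a, 'b) monoid_scheme \<Rightarrow> 'a list \<Rightarrow> 'a" where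
  "word_prod M w = foldr (mult M) w \<one>\<^bsub>M\<^esub>"

lemma word_prod_simps [simp]:
  "word_prod M [] = \<one>\<^bsub>M\<^esub>" "word_prod M (x # w) = x \<otimes>\<^bsub>M\<^esub> word_prod M w"
  by (simp_all add: word_prod_def)

context monoid
begin

lemma word_prod_closed [simp]: "w \<in> lists (carrier G) \<Longrightarrow> word_prod G w \<in> carrier G"
  by (induction w) auto

lemma word_prod_append:
  "u \<in> lists (carrier G) \<Longrightarrow> v \<in> lists (carrier G) \<Longrightarrow>
    word_prod G (u @ v) = word_prod G u \<otimes> word_prod G v"
  by (induction u) (auto simp: m_assoc)

lemma word_prod_concat_map:
  assumes "\<And>i. i \<in> set is \<Longrightarrow> U i \<in> lists (carrier G)"
  shows "word_prod G (concat (map U is)) = word_prod G (map (\<lambda>i. word_prod G (U i)) is)"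
  using assms
proof (induction "is")
  case (Cons i "is")
  have "concat (map U is) \<in> lists (carrier G)"
    using Cons.prems by (auto simp: in_lists_conv_set)
  then show ?case using Cons by (simp add: word_prod_append)
qed simp

text \<open>The equivalence carries the induction: through symmetry and transitivity, membership in
  \<open>lists (carrier G)\<close> has to travel in both directions.\<close>

lemma word_cong_sound:
  assumes "word_cong R u v" "R \<subseteq> lists (carrier G) \<times> lists (carrier G)"
    and "\<And>u v. (u, v) \<in> R \<Longrightarrow> word_prod G u = word_prod G v"
  shows "(u \<in> lists (carrier G) \<longleftrightarrow> v \<in> lists (carrier G)) \<and>
    (u \<in> lists (carrier G) \<longrightarrow> word_prod G u = word_prod G v)"
  using assms
  by (induction rule: word_cong.induct) (auto simp: word_prod_append)

end

text \<open>Links the inductive closure with the intersection in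
  \<open>generated_congruence\<close>: any congruence that contains the renamed relators contains
  the renamed pair. The renaming \<open>e\<close> will code generators as numbers.\<close>

lemma word_cong_imp_congruence:
  assumes "word_cong R u v" "R \<subseteq> lists S \<times> lists S"
    and E: "monoid_congruence (free_monoid A) E" and e: "e ` S \<subseteq> A" "inj_on e S"
    and R: "map_prod (map e) (map e) ` R \<subseteq> E"
  shows "(u \<in> lists S \<longleftrightarrow> v \<in> lists S) \<and> (u \<in> lists S \<longrightarrow> (map e u, map e v) \<in> E)"
  using assms(1)
proof induction
  case (base u v)
  then show ?case using assms(2) R by (auto)
next
  case (refl u)
  have "map e u \<in> lists A" if "u \<in> lists S"
    using that e(1) by (auto simp: in_lists_conv_set)
  then show ?case using E unfolding monoid_congruence_def free_monoid_def
    by (auto simp: equiv_def refl_on_def)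
next
  case (sym u v)
  then show ?case using E unfolding monoid_congruence_def
    by (auto simp: equiv_def dest: symD)
next
  case (trans u v w)
  then show ?case using E unfolding monoid_congruence_def
    by (auto simp: equiv_def dest: transD)
next
  case (append u u' v v')
  then show ?case using E unfolding monoid_congruence_def free_monoid_def
    by (auto)
qed

lemma finitely_presented_monoidI:
  assumes M: "monoid M" and S: "finite S" "S \<subseteq> carrier M"
    and R: "finite R" "R \<subseteq> lists S \<times> lists S"
    and gen: "carrier M \<subseteq> word_prod M ` lists S"
    and sound: "\<And>u v. (u, v) \<in> R \<Longrightarrow> word_prod M u = word_prod M v"
    and complete: "\<And>u v. u \<in> lists S \<Longrightarrow> v \<in> lists S \<Longrightarrow>
      word_prod M u = word_prod M v \<Longrightarrow> word_cong R u v"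
  shows "finitely_presented_monoid M"
proof -
  interpret monoid M by (rule M)
  obtain e :: "_ \<Rightarrow> nat" where e: "inj_on e S"
    using finite_imp_inj_to_nat_seg[OF S(1)] by metis
  define A where "A = e ` S"
  define d where "d = inv_into S e"
  define val where "val w = word_prod M (map d w)" for w
  define R' where "R' = map_prod (map e) (map e) ` R"
  define E where "E = {(u, v). u \<in> lists A \<and> v \<in> lists A \<and> val u = val v}"
  have dS: "map d w \<in> lists S" if "w \<in> lists A" for w
    using that unfolding A_def d_def by (induction w) (auto simp: inv_into_into)
  have SC: "w \<in> lists (carrier M)" if "w \<in> lists S" for w using that S lists_mono by blast
  have de: "map d (map e w) = w" if "w \<in> lists S" for w
    using that e unfolding d_def by (induction w) auto
  have ed: "map e (map d w) = w" if "w \<in> lists A" for w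
    using that unfolding d_def A_def by (induction w) (auto simp: f_inv_into_f)
  have eA: "map e w \<in> lists A" if "w \<in> lists S" for w
    using that unfolding A_def by (induction w) auto
  have R'A: "R' \<subseteq> lists A \<times> lists A"
    unfolding R'_def using R(2) eA by (auto)
  have val_append: "val (u @ v) = val u \<otimes>\<^bsub>M\<^esub> val v" if "u \<in> lists A" "v \<in> lists A" for u v
    using dS[OF that(1)] dS[OF that(2)] SC unfolding val_def by (simp add: word_prod_append)
  have val_closed: "val w \<in> carrier M" if "w \<in> lists A" for w
    unfolding val_def using dS[OF that] SC by (intro word_prod_closed)
  have congE: "monoid_congruence (free_monoid A) E"
    unfolding monoid_congruence_def free_monoid_def E_def
    by (auto simp: equiv_def refl_on_def sym_def trans_def val_append)
  have R'E: "R' \<subseteq> E"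
  proof (clarsimp simp: R'_def)
    fix u v assume uv: "(u, v) \<in> R"
    then have "u \<in> lists S" "v \<in> lists S" using R(2) by auto
    then show "(map e u, map e v) \<in> E"
      using de eA sound[OF uv] unfolding E_def val_def by (auto simp del: map_map)
  qed
  \<comment> \<open>The kernel of \<open>val\<close> is a congruence containing the relators, which
    gives one inclusion; \<open>complete\<close> gives the other.\<close>
  have gc: "generated_congruence (free_monoid A) R' = E"
  proof
    show "generated_congruence (free_monoid A) R' \<subseteq> E"
      unfolding generated_congruence_def using congE R'E by blast
    show "E \<subseteq> generated_congruence (free_monoid A) R'"
      unfolding generated_congruence_def
    proof (clarify)
      fix u v E' assume uv: "(u, v) \<in> E" and E': "monoid_congruence (free_monoid A) E'" "R' \<subseteq> E'"
      from uv have u: "u \<in> lists A" and v: "v \<in> lists A" and "val u = val v"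
        unfolding E_def by auto
      then have "word_cong R (map d u) (map d v)"
        using dS by (intro complete) (auto simp: val_def)
      from word_cong_imp_congruence[OF this R(2) E'(1)] e E'(2) dS[OF u]
      have "(map e (map d u), map e (map d v)) \<in> E'"
        unfolding A_def R'_def by (auto simp del: map_map)
      then show "(u, v) \<in> E'" using ed u v by (simp del: map_map)
    qed
  qed
  \<comment> \<open>An element is sent to its fibre under \<open>val\<close>, which is a class of
    \<open>E\<close>.\<close>
  define h where "h y = {w \<in> lists A. val w = y}" for y
  have hE: "E `` {w} = h (val w)" if "w \<in> lists A" for w
    using that unfolding h_def E_def by auto
  have surj: "\<exists>w \<in> lists A. val w = y" if y: "y \<in> carrier M" for y
  proof -
    from gen y obtain w where "w \<in> lists S" "word_prod M w = y" by auto
    then show ?thesis using de eA unfolding val_def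
      by (intro bexI[of _ "map e w"]) (auto simp del: map_map)
  qed
  let ?Q = "quotient_monoid (free_monoid A) E"
  have "h \<in> iso M ?Q"
    unfolding iso_def hom_def
  proof (clarsimp, intro conjI)
    show "h \<in> carrier M \<rightarrow> carrier ?Q"
    proof
      fix y assume "y \<in> carrier M"
      then obtain w where w: "w \<in> lists A" "val w = y" using surj by blast
      then have "h y = E `` {w}" using hE by simp
      then show "h y \<in> carrier ?Q" using w
        by (auto simp: quotient_monoid_def free_monoid_def quotientI)
    qed
    show "\<forall>x\<in>carrier M. \<forall>y\<in>carrier M. h (x \<otimes>\<^bsub>M\<^esub> y) = h x \<otimes>\<^bsub>?Q\<^esub> h y"
    proof (intro ballI)
      fix x y assume xy: "x \<in> carrier M" "y \<in> carrier M"
      have *: "E `` {u @ v} = h (x \<otimes>\<^bsub>M\<^esub> y)" if "u \<in> h x" "v \<in> h y" for u v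
      proof -
        from that have uv: "u \<in> lists A" "val u = x" "v \<in> lists A" "val v = y"
          unfolding h_def by auto
        then have "val (u @ v) = x \<otimes>\<^bsub>M\<^esub> y" using val_append by simp
        then show ?thesis using hE[of "u @ v"] uv by simp
      qed
      have "h x \<noteq> {}" "h y \<noteq> {}" using surj xy unfolding h_def by blast+
      moreover have "(\<Union>x\<in>h x. \<Union>y\<in>h y. E `` {x @ y}) =
          (\<Union>u\<in>h x. \<Union>v\<in>h y. h (x \<otimes>\<^bsub>M\<^esub> y))"
        using * by (intro SUP_cong refl) auto
      ultimately have "(\<Union>x\<in>h x. \<Union>y\<in>h y. E `` {x @ y}) = h (x \<otimes>\<^bsub>M\<^esub> y)"
        by simp
      then show "h (x \<otimes>\<^bsub>M\<^esub> y) = h x \<otimes>\<^bsub>?Q\<^esub> h y"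
        by (simp add: quotient_monoid_def free_monoid_def)
    qed
    show "bij_betw h (carrier M) (carrier ?Q)"
      unfolding bij_betw_def
    proof
      show "inj_on h (carrier M)"
      proof (rule inj_onI)
        fix x y assume "x \<in> carrier M" "h x = h y"
        moreover then obtain w where "w \<in> h x" using surj unfolding h_def by blast
        ultimately show "x = y" unfolding h_def by auto
      qed
      show "h ` carrier M = carrier ?Q"
      proof
        show "h ` carrier M \<subseteq> carrier ?Q"
          using \<open>h \<in> carrier M \<rightarrow> carrier ?Q\<close> by auto
        show "carrier ?Q \<subseteq> h ` carrier M"
          using hE val_closed
          by (auto simp: quotient_monoid_def free_monoid_def quotient_def)
      qed
    qed
  qed
  then have "M \<cong> quotient_monoid (free_monoid A) (generated_congruence (free_monoid A) R')"
    unfolding is_iso_def gc by auto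
  moreover have "finite A" "finite R'" unfolding A_def R'_def using S R by auto
  ultimately show ?thesis
    unfolding finitely_presented_monoid_def using M R'A by auto
qed

section \<open>Monoids with unique joins\<close>

text \<open>The last assumption makes the map from h to the family of all
  \<open>\<alpha> a \<otimes> h\<close> a bijection from M onto its K-th power, the structure of a
  Jonsson-Tarski algebra. The intended case is a space cut into K pieces, each a copy of the
  whole.\<close>

locale branching_monoid = monoid M for M (structure) +
  fixes K :: nat and \<alpha> :: "nat \<Rightarrow> 'a"
  assumes K: "K \<ge> 2"
    and \<alpha>_closed: "a < K \<Longrightarrow> \<alpha> a \<in> carrier M"
    and ex1_join: "(\<And>a. a < K \<Longrightarrow> f a \<in> carrier M) \<Longrightarrow>
      \<exists>!h. h \<in> carrier M \<and> (\<forall>a<K. \<alpha> a \<otimes> h = f a)"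
begin

definition join :: "(nat \<Rightarrow> 'a) \<Rightarrow> 'a" where
  "join f = (THE h. h \<in> carrier M \<and> (\<forall>a<K. \<alpha> a \<otimes> h = f a))"

lemma
  assumes "\<And>a. a < K \<Longrightarrow> f a \<in> carrier M"
  shows join_closed: "join f \<in> carrier M"
    and \<alpha>_join: "a < K \<Longrightarrow> \<alpha> a \<otimes> join f = f a"
  using theI'[OF ex1_join[OF assms]] unfolding join_def by auto

lemma \<alpha>_join_mult:
  assumes "\<And>a. a < K \<Longrightarrow> f a \<in> carrier M" "h \<in> carrier M" "a < K"
  shows "\<alpha> a \<otimes> (join f \<otimes> h) = f a \<otimes> h"
  using assms \<alpha>_join[of f a] join_closed[of f] \<alpha>_closed[of a]
  by (simp flip: m_assoc)

text \<open>Uniqueness of joins is joint left cancellation; nearly every identity below is checked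
  piece by piece with it.\<close>

lemma eqI_\<alpha>:
  assumes "g \<in> carrier M" "h \<in> carrier M" "\<And>a. a < K \<Longrightarrow> \<alpha> a \<otimes> g = \<alpha> a \<otimes> h"
  shows "g = h"
  using ex1_join[of "\<lambda>a. \<alpha> a \<otimes> h"] assms \<alpha>_closed by auto

text \<open>In a monoid of maps, \<open>local_map a y\<close> acts as \<open>y\<close> inside the \<open>a\<close>-th piece, the image of
  \<open>\<alpha> a\<close>, and fixes all other pieces.\<close>

definition local_map :: "nat \<Rightarrow> 'a \<Rightarrow> 'a" where
  "local_map a y = join (\<lambda>b. if b = a then y \<otimes> \<alpha> a else \<alpha> b)"

lemma local_map_closed: "y \<in> carrier M \<Longrightarrow> a < K \<Longrightarrow> local_map a y \<in> carrier M"
  unfolding local_map_def by (rule join_closed) (auto simp: \<alpha>_closed)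

lemma \<alpha>_local_map:
  assumes "y \<in> carrier M" "a < K" "b < K"
  shows "\<alpha> b \<otimes> local_map a y = (if b = a then y \<otimes> \<alpha> a else \<alpha> b)"
  unfolding local_map_def using assms by (subst \<alpha>_join) (auto simp: \<alpha>_closed)

lemma \<alpha>_local_map_mult:
  assumes "y \<in> carrier M" "a < K" "b < K" "h \<in> carrier M"
  shows "\<alpha> b \<otimes> (local_map a y \<otimes> h) = (if b = a then y \<otimes> (\<alpha> a \<otimes> h) else \<alpha> b \<otimes> h)"
  unfolding local_map_def using assms by (subst \<alpha>_join_mult) (auto simp: \<alpha>_closed m_assoc)

lemma local_map_one: "a < K \<Longrightarrow> local_map a \<one> = \<one>"
  by (rule eqI_\<alpha>) (auto simp: local_map_closed \<alpha>_local_map \<alpha>_closed)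

lemma local_map_mult:
  assumes "x \<in> carrier M" "y \<in> carrier M" "a < K"
  shows "local_map a (x \<otimes> y) = local_map a x \<otimes> local_map a y"
  using assms
  by - (rule eqI_\<alpha>, auto simp: local_map_closed \<alpha>_local_map \<alpha>_local_map_mult \<alpha>_closed m_assoc)

lemma local_map_commute:
  assumes "x \<in> carrier M" "y \<in> carrier M" "a < K" "b < K" "a \<noteq> b"
  shows "local_map a x \<otimes> local_map b y = local_map b y \<otimes> local_map a x"
  using assms
  by - (rule eqI_\<alpha>, auto simp: local_map_closed \<alpha>_local_map \<alpha>_local_map_mult \<alpha>_closed)

text \<open>For m < K the remaining pieces are still fixed, so the partial products are joins as
  well and the induction can add one piece at a time.\<close>

lemma local_map_prod:
  assumes "\<And>a. a < m \<Longrightarrow> y a \<in> carrier M" "m \<le> K"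
  shows "word_prod M (map (\<lambda>a. local_map a (y a)) [0..<m]) =
    join (\<lambda>b. if b < m then y b \<otimes> \<alpha> b else \<alpha> b)"
  using assms
proof (induction m)
  case 0
  show ?case by (rule eqI_\<alpha>) (auto simp: join_closed \<alpha>_join \<alpha>_closed)
next
  case (Suc m)
  let ?f = "\<lambda>m b. if b < m then y b \<otimes> \<alpha> b else \<alpha> b"
  have f: "b < K \<Longrightarrow> ?f m b \<in> carrier M" "b < K \<Longrightarrow> ?f (Suc m) b \<in> carrier M" for b
    using Suc.prems \<alpha>_closed by auto
  have "map (\<lambda>a. local_map a (y a)) [0..<m] \<in> lists (carrier M)"
    using Suc.prems by (auto simp: in_lists_conv_set local_map_closed)
  then have "word_prod M (map (\<lambda>a. local_map a (y a)) [0..<Suc m]) =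
      join (?f m) \<otimes> local_map m (y m)"
    using Suc local_map_closed by (simp add: word_prod_append)
  also have "\<dots> = join (?f (Suc m))"
  proof (rule eqI_\<alpha>)
    show "join (?f m) \<otimes> local_map m (y m) \<in> carrier M" "join (?f (Suc m)) \<in> carrier M"
      using f Suc.prems by (auto intro!: m_closed join_closed local_map_closed)
    fix a assume a: "a < K"
    have "\<alpha> a \<otimes> (join (?f m) \<otimes> local_map m (y m)) = ?f m a \<otimes> local_map m (y m)"
      using f Suc.prems a by (intro \<alpha>_join_mult) (auto simp: local_map_closed)
    also have "\<dots> = ?f (Suc m) a"
      using Suc.prems a by (auto simp: less_Suc_eq m_assoc \<alpha>_local_map \<alpha>_closed local_map_closed)
    also have "\<dots> = \<alpha> a \<otimes> join (?f (Suc m))"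
      using \<alpha>_join[of "?f (Suc m)" a] f a by simp
    finally show "\<alpha> a \<otimes> (join (?f m) \<otimes> local_map m (y m)) = \<alpha> a \<otimes> join (?f (Suc m))" .
  qed
  finally show ?case .
qed

section \<open>Units that move and rescale pieces\<close>

definition swap :: "nat \<Rightarrow> 'a" where
  "swap a = join (\<lambda>b. if b = 0 then \<alpha> a else if b = a then \<alpha> 0 else \<alpha> b)"

lemma
  assumes "a < K"
  shows swap_closed: "swap a \<in> carrier M"
    and \<alpha>_swap: "b < K \<Longrightarrow>
      \<alpha> b \<otimes> swap a = (if b = 0 then \<alpha> a else if b = a then \<alpha> 0 else \<alpha> b)"
    and \<alpha>_swap_mult: "b < K \<Longrightarrow> h \<in> carrier M \<Longrightarrow>
      \<alpha> b \<otimes> (swap a \<otimes> h) = (if b = 0 then \<alpha> a else if b = a then \<alpha> 0 else \<alpha> b) \<otimes> h"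
proof -
  let ?f = "\<lambda>b. if b = 0 then \<alpha> a else if b = a then \<alpha> 0 else \<alpha> b"
  have f: "?f b \<in> carrier M" if "b < K" for b using assms that K \<alpha>_closed by auto
  show "swap a \<in> carrier M" unfolding swap_def by (rule join_closed[of ?f, OF f])
  show "\<alpha> b \<otimes> swap a = ?f b" if "b < K"
    unfolding swap_def by (rule \<alpha>_join[of ?f, OF f that])
  show "\<alpha> b \<otimes> (swap a \<otimes> h) = ?f b \<otimes> h" if "b < K" "h \<in> carrier M"
    unfolding swap_def by (rule \<alpha>_join_mult[of ?f, OF f that(2,1)])
qed

lemma swap_swap: "a < K \<Longrightarrow> swap a \<otimes> swap a = \<one>"
  using K by - (rule eqI_\<alpha>, auto simp: swap_closed \<alpha>_swap_mult \<alpha>_swap \<alpha>_closed)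

text \<open>\<open>swap a\<close> is an involution exchanging pieces 0 and a, so relators for
  \<open>local_map 0\<close> will take care of every piece.\<close>

lemma local_map_conj:
  assumes "y \<in> carrier M" "a < K"
  shows "local_map a y = swap a \<otimes> (local_map 0 y \<otimes> swap a)"
  using assms K
  by - (rule eqI_\<alpha>, auto simp: swap_closed local_map_closed \<alpha>_swap_mult \<alpha>_swap \<alpha>_local_map \<alpha>_local_map_mult
      \<alpha>_closed m_assoc)

text \<open>An analogue of the generator \<open>x\<^sub>0\<close> of Thompson's group \<open>F\<close>: a unit that shrinks piece \<open>0\<close>
  to its own piece \<open>0\<close>.  It makes the iterates of \<open>local_map 0\<close> conjugate to \<open>local_map 0\<close>
  itself.\<close>

definition shrink :: 'a where
  "shrink = join (\<lambda>b. if b = 0 then \<alpha> 0 \<otimes> \<alpha> 0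
     else if b = 1 then join (\<lambda>c. if c = 0 then \<alpha> 1 else \<alpha> c \<otimes> \<alpha> 0)
     else \<alpha> b)"

text \<open>The inverse of \<open>shrink\<close>. The right factor is applied last, so
  \<open>\<alpha> c \<otimes> \<alpha> b\<close> stands for subpiece c of piece b: subpiece 0 of
  piece 0 grows to the whole piece, its other subpieces move into piece 1, and piece 1 gives way by
  shrinking onto its own subpiece 0.\<close>

definition unshrink :: 'a where
  "unshrink = join (\<lambda>b. if b = 0 then join (\<lambda>c. if c = 0 then \<alpha> 0 else \<alpha> c \<otimes> \<alpha> 1)
     else if b = 1 then \<alpha> 0 \<otimes> \<alpha> 1
     else \<alpha> b)"

lemma inner_closed:
  "a < K \<Longrightarrow> b < K \<Longrightarrow> join (\<lambda>c. if c = 0 then \<alpha> a else \<alpha> c \<otimes> \<alpha> b) \<in> carrier M"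
  by (intro join_closed) (auto simp: \<alpha>_closed)

lemma
  shows shrink_closed: "shrink \<in> carrier M"
    and \<alpha>_shrink: "b < K \<Longrightarrow> \<alpha> b \<otimes> shrink = (if b = 0 then \<alpha> 0 \<otimes> \<alpha> 0
     else if b = 1 then join (\<lambda>c. if c = 0 then \<alpha> 1 else \<alpha> c \<otimes> \<alpha> 0) else \<alpha> b)"
    and \<alpha>_shrink_mult: "b < K \<Longrightarrow> h \<in> carrier M \<Longrightarrow>
      \<alpha> b \<otimes> (shrink \<otimes> h) = (if b = 0 then \<alpha> 0 \<otimes> \<alpha> 0
     else if b = 1 then join (\<lambda>c. if c = 0 then \<alpha> 1 else \<alpha> c \<otimes> \<alpha> 0) else \<alpha> b) \<otimes> h"
proof -
  let ?f = "\<lambda>b. if b = 0 then \<alpha> 0 \<otimes> \<alpha> 0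
     else if b = 1 then join (\<lambda>c. if c = 0 then \<alpha> 1 else \<alpha> c \<otimes> \<alpha> 0)
     else \<alpha> b"
  have f: "?f b \<in> carrier M" if "b < K" for b
    using that K inner_closed[of 1 0] inner_closed[of 0 1] \<alpha>_closed by auto
  show "shrink \<in> carrier M" unfolding shrink_def by (rule join_closed[of ?f, OF f])
  show "\<alpha> b \<otimes> shrink = ?f b" if "b < K"
    unfolding shrink_def by (rule \<alpha>_join[of ?f, OF f that])
  show "\<alpha> b \<otimes> (shrink \<otimes> h) = ?f b \<otimes> h" if "b < K" "h \<in> carrier M"
    unfolding shrink_def by (rule \<alpha>_join_mult[of ?f, OF f that(2,1)])
qed

lemma
  shows unshrink_closed: "unshrink \<in> carrier M"
    and \<alpha>_unshrink: "b < K \<Longrightarrow> \<alpha> b \<otimes> unshrink =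
      (if b = 0 then join (\<lambda>c. if c = 0 then \<alpha> 0 else \<alpha> c \<otimes> \<alpha> 1)
       else if b = 1 then \<alpha> 0 \<otimes> \<alpha> 1 else \<alpha> b)"
    and \<alpha>_unshrink_mult: "b < K \<Longrightarrow> h \<in> carrier M \<Longrightarrow> \<alpha> b \<otimes> (unshrink \<otimes> h) =
      (if b = 0 then join (\<lambda>c. if c = 0 then \<alpha> 0 else \<alpha> c \<otimes> \<alpha> 1)
       else if b = 1 then \<alpha> 0 \<otimes> \<alpha> 1 else \<alpha> b) \<otimes> h"
proof -
  let ?f = "\<lambda>b. if b = 0 then join (\<lambda>c. if c = 0 then \<alpha> 0 else \<alpha> c \<otimes> \<alpha> 1)
     else if b = 1 then \<alpha> 0 \<otimes> \<alpha> 1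
     else \<alpha> b"
  have f: "?f b \<in> carrier M" if "b < K" for b
    using that K inner_closed[of 1 0] inner_closed[of 0 1] \<alpha>_closed by auto
  show "unshrink \<in> carrier M" unfolding unshrink_def by (rule join_closed[of ?f, OF f])
  show "\<alpha> b \<otimes> unshrink = ?f b" if "b < K"
    unfolding unshrink_def by (rule \<alpha>_join[of ?f, OF f that])
  show "\<alpha> b \<otimes> (unshrink \<otimes> h) = ?f b \<otimes> h" if "b < K" "h \<in> carrier M"
    unfolding unshrink_def by (rule \<alpha>_join_mult[of ?f, OF f that(2,1)])
qed

lemma
  assumes "a < K" "b < K" "d < K"
  shows \<alpha>_inner: "\<alpha> d \<otimes> join (\<lambda>c. if c = 0 then \<alpha> a else \<alpha> c \<otimes> \<alpha> b) =
      (if d = 0 then \<alpha> a else \<alpha> d \<otimes> \<alpha> b)"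
    and \<alpha>_inner_mult: "h \<in> carrier M \<Longrightarrow>
      \<alpha> d \<otimes> (join (\<lambda>c. if c = 0 then \<alpha> a else \<alpha> c \<otimes> \<alpha> b) \<otimes> h) =
      (if d = 0 then \<alpha> a else \<alpha> d \<otimes> \<alpha> b) \<otimes> h"
proof -
  let ?f = "\<lambda>c. if c = 0 then \<alpha> a else \<alpha> c \<otimes> \<alpha> b"
  have f: "?f b \<in> carrier M" if "b < K" for b
    using assms that \<alpha>_closed by auto
  show "\<alpha> d \<otimes> join ?f = ?f d" by (rule \<alpha>_join[of ?f, OF f assms(3)])
  show "\<alpha> d \<otimes> (join ?f \<otimes> h) = ?f d \<otimes> h" if "h \<in> carrier M"
    by (rule \<alpha>_join_mult[of ?f, OF f that assms(3)])
qed

lemma shrink_unshrink: "shrink \<otimes> unshrink = \<one>"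
proof (rule eqI_\<alpha>)
  fix a assume a: "a < K"
  have 1: "join (\<lambda>c. if c = 0 then \<alpha> 1 else \<alpha> c \<otimes> \<alpha> 0) \<otimes> unshrink = \<alpha> 1"
    using K by - (rule eqI_\<alpha>, auto simp: inner_closed shrink_closed unshrink_closed \<alpha>_inner \<alpha>_inner_mult \<alpha>_unshrink
        \<alpha>_closed m_assoc)
  show "\<alpha> a \<otimes> (shrink \<otimes> unshrink) = \<alpha> a \<otimes> \<one>"
    using a K 1 by (auto simp: \<alpha>_shrink_mult unshrink_closed \<alpha>_unshrink \<alpha>_closed m_assoc \<alpha>_inner)
qed (auto simp: shrink_closed unshrink_closed)

lemma unshrink_shrink: "unshrink \<otimes> shrink = \<one>"
proof (rule eqI_\<alpha>)
  fix a assume a: "a < K"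
  have 1: "join (\<lambda>c. if c = 0 then \<alpha> 0 else \<alpha> c \<otimes> \<alpha> 1) \<otimes> shrink = \<alpha> 0"
    using K by - (rule eqI_\<alpha>,
      auto simp: inner_closed shrink_closed unshrink_closed \<alpha>_inner \<alpha>_inner_mult \<alpha>_shrink
        \<alpha>_closed m_assoc)
  show "\<alpha> a \<otimes> (unshrink \<otimes> shrink) = \<alpha> a \<otimes> \<one>"
    using a K 1 by (auto simp: \<alpha>_unshrink_mult shrink_closed \<alpha>_shrink \<alpha>_closed m_assoc \<alpha>_inner)
qed (auto simp: shrink_closed unshrink_closed)

text \<open>The left side acts inside subpiece 0 of piece 0 and fixes the rest.
  \<open>unshrink\<close> enlarges this subpiece to piece 0, \<open>local_map 0 y\<close> acts
  there, and \<open>shrink\<close> restores the position.\<close>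

lemma local_map_local_map:
  assumes y: "y \<in> carrier M"
  shows "local_map 0 (local_map 0 y) = unshrink \<otimes> (local_map 0 y \<otimes> shrink)"
proof (rule eqI_\<alpha>)
  have K0: "0 < K" "1 < K" using K by auto
  note closed = y K0 local_map_closed shrink_closed unshrink_closed inner_closed \<alpha>_closed
  have "local_map 0 y \<otimes> \<alpha> 0 =
    join (\<lambda>c. if c = 0 then \<alpha> 0 else \<alpha> c \<otimes> \<alpha> 1) \<otimes> (local_map 0 y \<otimes> shrink)"
  proof (rule eqI_\<alpha>)
    fix a assume a: "a < K"
    then show "\<alpha> a \<otimes> (local_map 0 y \<otimes> \<alpha> 0) = \<alpha> a \<otimes>
      (join (\<lambda>c. if c = 0 then \<alpha> 0 else \<alpha> c \<otimes> \<alpha> 1) \<otimes> (local_map 0 y \<otimes> shrink))"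
      using closed
      by (auto simp: \<alpha>_inner_mult \<alpha>_local_map_mult \<alpha>_shrink \<alpha>_inner m_assoc \<alpha>_local_map)
  qed (use closed in auto)
  moreover have "\<alpha> 0 \<otimes> (\<alpha> 1 \<otimes> (local_map 0 y \<otimes> shrink)) = \<alpha> 1"
    using closed by (simp add: \<alpha>_local_map_mult \<alpha>_shrink \<alpha>_inner)
  moreover fix a assume "a < K"
  ultimately show "\<alpha> a \<otimes> local_map 0 (local_map 0 y) =
      \<alpha> a \<otimes> (unshrink \<otimes> (local_map 0 y \<otimes> shrink))"
    using closed
    by (auto simp: \<alpha>_local_map \<alpha>_unshrink_mult \<alpha>_local_map_mult \<alpha>_shrink m_assoc)
qed (use y K in \<open>auto simp: local_map_closed shrink_closed unshrink_closed\<close>)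

end

section \<open>A finite presentation from leaf normal forms\<close>

primrec words_pow :: "'a list set \<Rightarrow> nat \<Rightarrow> 'a list set" where
  "words_pow B 0 = {[]}"
| "words_pow B (Suc m) = (\<lambda>(b, v). b @ v) ` (B \<times> words_pow B m)"

lemma concat_in_lists: "(\<And>u. u \<in> set us \<Longrightarrow> u \<in> lists A) \<Longrightarrow> concat us \<in> lists A"
  by (induction us) auto

lemma finite_words_pow: "finite B \<Longrightarrow> finite (words_pow B m)"
  by (induction m) auto

lemma words_pow_lists: "B \<subseteq> lists A \<Longrightarrow> words_pow B m \<subseteq> lists A"
  by (induction m) auto

lemma words_pow_SucE:
  assumes "v \<in> words_pow B (Suc m)"
  obtains b v' where "v = b @ v'" "b \<in> B" "v' \<in> words_pow B m"
  using assms by auto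

lemma words_pow_add:
  assumes "v \<in> words_pow B (l + m)"
  obtains v1 v2 where "v = v1 @ v2" "v1 \<in> words_pow B l" "v2 \<in> words_pow B m"
  using assms
proof (induction l arbitrary: v thesis)
  case (Suc l)
  then obtain b v' where v: "v = b @ v'" "b \<in> B" "v' \<in> words_pow B (l + m)" by auto
  obtain v1 v2 where "v' = v1 @ v2" "v1 \<in> words_pow B l" "v2 \<in> words_pow B m"
    using Suc.IH[OF _ v(3)] by blast
  then show ?case using v by (intro Suc.prems(1)[of "b @ v1" v2]) auto
qed simp

text \<open>\<open>LW\<close> is a set of normal forms for the elements of a subsemigroup, \<open>B\<close> is a finite subset
  of it that is jointly left cancellable, and every element is driven into the subsemigroup by
  left multiplication with long products over \<open>B\<close>.\<close>

locale leaf_monoid = branching_monoid M K \<alpha> for M (structure) and K \<alpha> +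
  fixes G :: "'a set" and RL :: "('a list \<times> 'a list) set" and LW B :: "'a list set"
    and \<theta> \<theta>' :: 'a
  assumes G: "finite G" "G \<subseteq> carrier M"
    and RL: "finite RL" "RL \<subseteq> lists G \<times> lists G"
    and RL_sound: "(u, v) \<in> RL \<Longrightarrow> word_prod M u = word_prod M v"
    and LW: "LW \<subseteq> lists G"
    and inj_LW: "inj_on (word_prod M) LW"
    and LW_append: "u \<in> LW \<Longrightarrow> v \<in> LW \<Longrightarrow> \<exists>w\<in>LW. word_cong RL (u @ v) w"
    and B: "finite B" "B \<subseteq> LW"
    and B_LW: "b \<in> B \<Longrightarrow> u \<in> LW \<Longrightarrow> \<exists>l\<in>LW. \<exists>b'\<in>B. word_prod M (b @ u) = word_prod M (l @ b')"
    and deep: "f \<in> carrier M \<Longrightarrow>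
      \<exists>m. \<forall>v\<in>words_pow B (Suc m). word_prod M v \<otimes> f \<in> word_prod M ` LW"
    and \<theta>: "\<theta> \<in> carrier M" "\<theta>' \<in> carrier M" "\<theta>' \<otimes> \<theta> = \<one>"
    and \<alpha>_\<theta>: "a < K \<Longrightarrow> \<exists>b\<in>B. \<alpha> a \<otimes> \<theta> = word_prod M b"
begin

section \<open>Joins as products, and a finite generating set\<close>

definition \<mu> :: 'a where
  "\<mu> = join (\<lambda>_. \<one>)"

lemma \<mu>_closed: "\<mu> \<in> carrier M"
  unfolding \<mu>_def by (rule join_closed) auto

text \<open>Each local map performs \<open>f a\<close> inside piece a, and \<mu> then removes the
  label of the piece because \<open>\<alpha> a \<otimes> \<mu> = \<one>\<close>.\<close>

lemma join_eq_prod: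
  assumes f: "\<And>a. a < K \<Longrightarrow> f a \<in> carrier M"
  shows "join f = word_prod M (map (\<lambda>a. local_map a (f a)) [0..<K]) \<otimes> \<mu>"
proof -
  let ?f = "\<lambda>b. if b < K then f b \<otimes> \<alpha> b else \<alpha> b"
  have f': "?f b \<in> carrier M" if "b < K" for b using that f \<alpha>_closed by auto
  have "join f = join ?f \<otimes> \<mu>"
  proof (rule eqI_\<alpha>)
    fix a assume a: "a < K"
    have "\<alpha> a \<otimes> (join ?f \<otimes> \<mu>) = ?f a \<otimes> \<mu>"
      by (rule \<alpha>_join_mult[OF f' \<mu>_closed a])
    also have "\<dots> = f a"
      using a f \<alpha>_closed \<mu>_closed \<alpha>_join[of "\<lambda>_. \<one>" a] by (simp add: m_assoc \<mu>_def)
    also have "\<dots> = \<alpha> a \<otimes> join f" using \<alpha>_join[OF f a] by simp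
    finally show "\<alpha> a \<otimes> join f = \<alpha> a \<otimes> (join ?f \<otimes> \<mu>)" ..
  qed (use f \<mu>_closed join_closed[of f] join_closed[of ?f, OF f'] in auto)
  then show ?thesis using local_map_prod[of K f] f by simp
qed

definition S0 :: "'a set" where
  "S0 = G \<union> \<alpha> ` {..<K} \<union> swap ` {..<K} \<union> {shrink, unshrink, \<mu>, \<theta>, \<theta>'}"

text \<open>One layer of local maps is enough: a second application of \<open>local_map 0\<close> is
  a conjugate of the first, so the generated submonoid is closed under
  \<open>local_map 0\<close>.\<close>

definition S :: "'a set" where
  "S = S0 \<union> local_map 0 ` S0"

lemma S0_closed: "S0 \<subseteq> carrier M"
  unfolding S0_def
  using G \<alpha>_closed swap_closed shrink_closed unshrink_closed \<mu>_closed \<theta> by auto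

lemma S_closed: "S \<subseteq> carrier M"
  using S0_closed local_map_closed[of _ 0] K unfolding S_def by auto

lemma finite_S: "finite S"
  unfolding S_def S0_def using G by auto

lemma lists_S_closed: "w \<in> lists S \<Longrightarrow> w \<in> lists (carrier M)"
  using S_closed lists_mono by blast

lemma LW_lists_S: "w \<in> LW \<Longrightarrow> w \<in> lists S"
  using LW lists_mono[of G S] unfolding S_def S0_def by auto

lemma mem_S:
  "x \<in> G \<Longrightarrow> x \<in> S" "a < K \<Longrightarrow> \<alpha> a \<in> S" "a < K \<Longrightarrow> swap a \<in> S"
  "shrink \<in> S" "unshrink \<in> S" "\<mu> \<in> S" "\<theta> \<in> S" "\<theta>' \<in> S"
  unfolding S_def S0_def by auto

text \<open>The generated submonoid is closed under local maps, hence under joins, hence contains f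
  as soon as it contains the products of f with all members of B on the left. By
  \<open>deep\<close>, iterating this ends in values of \<open>LW\<close>, whose words use letters
  of G only.\<close>

lemma carrier_generated: "carrier M \<subseteq> word_prod M ` lists S"
proof -
  let ?H = "word_prod M ` lists S"
  have H_mult: "x \<otimes> y \<in> ?H" if xy: "x \<in> ?H" "y \<in> ?H" for x y
  proof -
    obtain u v where "u \<in> lists S" "v \<in> lists S" "x = word_prod M u" "y = word_prod M v"
      using xy by auto
    then have "x \<otimes> y = word_prod M (u @ v)" "u @ v \<in> lists S"
      by (simp_all add: word_prod_append lists_S_closed)
    then show ?thesis by blast
  qed
  have H_carrier: "x \<in> carrier M" if "x \<in> ?H" for x
    using that by (auto intro!: word_prod_closed lists_S_closed)
  have H_gen: "x \<in> ?H" if "x \<in> S" for x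
    using that S_closed image_eqI[of x "word_prod M" "[x]" "lists S"] by auto
  have H_one: "\<one> \<in> ?H"
    using image_eqI[of \<one> "word_prod M" "[]" "lists S"] by simp
  have loc_gen: "local_map 0 x \<in> ?H" if x: "x \<in> S" for x
  proof (cases "x \<in> S0")
    case True
    then show ?thesis by (intro H_gen) (simp add: S_def)
  next
    case False
    then obtain z where z: "z \<in> S0" "x = local_map 0 z" using x unfolding S_def by auto
    then have eq: "local_map 0 x = unshrink \<otimes> (x \<otimes> shrink)"
      using local_map_local_map[of z] S0_closed by auto
    show ?thesis
      unfolding eq by (rule H_mult[OF H_gen[OF mem_S(5)] H_mult[OF H_gen[OF x] H_gen[OF mem_S(4)]]])
  qed
  have loc0: "local_map 0 x \<in> ?H" if "x \<in> ?H" for x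
  proof -
    have "local_map 0 (word_prod M w) \<in> ?H" if "w \<in> lists S" for w
      using that
    proof (induction w)
      case Nil
      then show ?case using local_map_one[of 0] K H_one by simp
    next
      case (Cons x w)
      then have "local_map 0 (word_prod M (x # w)) = local_map 0 x \<otimes> local_map 0 (word_prod M w)"
        using local_map_mult[of x "word_prod M w" 0] K S_closed lists_S_closed by auto
      then show ?case using Cons by (simp add: H_mult loc_gen)
    qed
    then show ?thesis using that by auto
  qed
  have loc: "local_map a x \<in> ?H" if "x \<in> ?H" "a < K" for x a
    using local_map_conj[OF H_carrier that(2)] that by (simp add: H_mult H_gen mem_S loc0)
  have H_join: "join f \<in> ?H" if f: "\<And>a. a < K \<Longrightarrow> f a \<in> ?H" for f
  proof -
    have "word_prod M w \<in> ?H" if "set w \<subseteq> ?H" for w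
      using that by (induction w) (auto simp: H_one intro!: H_mult)
    then have "word_prod M (map (\<lambda>a. local_map a (f a)) [0..<K]) \<in> ?H"
      using loc f by (auto simp: image_subset_iff)
    then show ?thesis
      using join_eq_prod[of f] H_carrier[OF f] by (simp add: H_mult H_gen mem_S)
  qed
  \<comment> \<open>\<open>\<theta> \<otimes> f\<close> is the join of the
    \<open>\<alpha> a \<otimes> (\<theta> \<otimes> f)\<close>, each a member of B times f, and
    \<theta>' recovers f.\<close>
  have H_B: "f \<in> ?H" if f: "f \<in> carrier M" and b: "\<And>b. b \<in> B \<Longrightarrow> word_prod M b \<otimes> f \<in> ?H" for f
  proof -
    have "\<alpha> a \<otimes> (\<theta> \<otimes> f) \<in> ?H" if a: "a < K" for a
      using \<alpha>_\<theta>[OF a] b f \<theta> \<alpha>_closed[OF a] by (auto simp flip: m_assoc)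
    then have "join (\<lambda>a. \<alpha> a \<otimes> (\<theta> \<otimes> f)) \<in> ?H" by (rule H_join)
    moreover have "join (\<lambda>a. \<alpha> a \<otimes> (\<theta> \<otimes> f)) = \<theta> \<otimes> f"
      using f \<theta> \<alpha>_closed by - (rule eqI_\<alpha>, auto simp: join_closed \<alpha>_join)
    ultimately have "\<theta>' \<otimes> (\<theta> \<otimes> f) \<in> ?H" by (simp add: H_mult H_gen mem_S)
    then show ?thesis using f \<theta> by (simp flip: m_assoc)
  qed
  have B_lists: "words_pow B m \<subseteq> lists (carrier M)" for m
    using words_pow_lists[of B S m] B LW_lists_S lists_S_closed by blast
  have H_pow: "f \<in> ?H"
    if "f \<in> carrier M" "\<And>v. v \<in> words_pow B m \<Longrightarrow> word_prod M v \<otimes> f \<in> ?H" for f m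
    using that(2)
  proof (induction m)
    case 0
    then show ?case using that(1) by auto
  next
    case (Suc m)
    show ?case
    proof (rule Suc.IH)
      fix v assume v: "v \<in> words_pow B m"
      then have vC: "v \<in> lists (carrier M)" using B_lists by blast
      show "word_prod M v \<otimes> f \<in> ?H"
      proof (rule H_B)
        show "word_prod M v \<otimes> f \<in> carrier M" using vC that by simp
        fix b assume b: "b \<in> B"
        then have bC: "b \<in> lists (carrier M)" using B LW_lists_S lists_S_closed by blast
        have "word_prod M (b @ v) \<otimes> f \<in> ?H" using v b by (intro Suc.prems) auto
        then show "word_prod M b \<otimes> (word_prod M v \<otimes> f) \<in> ?H"
          using bC vC that by (simp add: word_prod_append m_assoc)
      qed
    qed
  qed
  show ?thesis
  proof
    fix f assume f: "f \<in> carrier M"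
    obtain m where "\<forall>v\<in>words_pow B (Suc m). word_prod M v \<otimes> f \<in> word_prod M ` LW"
      using deep[OF f] by blast
    moreover have "word_prod M ` LW \<subseteq> ?H" using LW_lists_S by auto
    ultimately show "f \<in> ?H" using H_pow[OF f, of "Suc m"] by blast
  qed
qed

section \<open>Words for local maps\<close>

definition word_of :: "'a \<Rightarrow> 'a list" where
  "word_of y = (SOME w. w \<in> lists S \<and> word_prod M w = y)"

lemma
  assumes "y \<in> carrier M"
  shows word_of_lists: "word_of y \<in> lists S"
    and word_prod_word_of: "word_prod M (word_of y) = y"
proof -
  have "\<exists>w. w \<in> lists S \<and> word_prod M w = y" using carrier_generated assms by auto
  then have "word_of y \<in> lists S \<and> word_prod M (word_of y) = y"
    unfolding word_of_def by (rule someI_ex)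
  then show "word_of y \<in> lists S" "word_prod M (word_of y) = y" by auto
qed

text \<open>Lifts the endomorphism \<open>local_map 0\<close> to words; an arbitrary word is chosen
  for the image of each letter.\<close>

definition loc_word :: "'a list \<Rightarrow> 'a list" where
  "loc_word w = concat (map (\<lambda>x. word_of (local_map 0 x)) w)"

lemma loc_word_append: "loc_word (u @ v) = loc_word u @ loc_word v"
  by (simp add: loc_word_def)

lemma loc_word_Nil: "loc_word [] = []"
  by (simp add: loc_word_def)

lemma local_map_0_closed: "x \<in> S \<Longrightarrow> local_map 0 x \<in> carrier M"
  using S_closed local_map_closed[of x 0] K by auto

lemma loc_word_lists: "w \<in> lists S \<Longrightarrow> loc_word w \<in> lists S"
  unfolding loc_word_def by (induction w) (auto simp: word_of_lists local_map_0_closed)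

lemma word_prod_loc_word:
  "w \<in> lists S \<Longrightarrow> word_prod M (loc_word w) = local_map 0 (word_prod M w)"
proof (induction w)
  case Nil
  then show ?case using K by (simp add: loc_word_def local_map_one)
next
  case (Cons x w)
  have "word_prod M (loc_word (x # w)) = local_map 0 x \<otimes> word_prod M (loc_word w)"
    using Cons loc_word_lists[of w] lists_S_closed word_of_lists[OF local_map_0_closed[of x]]
      word_prod_word_of[OF local_map_0_closed[of x]]
    by (simp add: loc_word_def word_prod_append)
  then show ?case
    using Cons local_map_mult[of x "word_prod M w" 0] K S_closed lists_S_closed by auto
qed

text \<open>Copies the conjugation formula \<open>local_map_conj\<close> at the level of
  words.\<close>

definition piece_word :: "nat \<Rightarrow> 'a list \<Rightarrow> 'a list" where
  "piece_word a w = [swap a] @ loc_word w @ [swap a]"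

lemma piece_word_lists: "a < K \<Longrightarrow> w \<in> lists S \<Longrightarrow> piece_word a w \<in> lists S"
  by (simp add: piece_word_def mem_S loc_word_lists)

lemma word_prod_piece_word:
  assumes "a < K" "w \<in> lists S"
  shows "word_prod M (piece_word a w) = local_map a (word_prod M w)"
proof -
  have "loc_word w \<in> lists (carrier M)" "word_prod M w \<in> carrier M"
    using assms loc_word_lists lists_S_closed by auto
  then show ?thesis
    using assms swap_closed[of a]
    by (simp add: piece_word_def word_prod_append word_prod_loc_word local_map_conj[of "word_prod M w" a])
qed

definition pieces_word :: "(nat \<Rightarrow> 'a list) \<Rightarrow> 'a list" where
  "pieces_word U = concat (map (\<lambda>a. piece_word a (U a)) [0..<K])"

lemma pieces_word_lists: "(\<And>a. a < K \<Longrightarrow> U a \<in> lists S) \<Longrightarrow> pieces_word U \<in> lists S"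
  unfolding pieces_word_def by (rule concat_in_lists) (auto intro: piece_word_lists)

lemma word_prod_pieces_word:
  assumes U: "\<And>a. a < K \<Longrightarrow> U a \<in> lists S"
  shows "word_prod M (pieces_word U @ [\<mu>]) = join (\<lambda>a. word_prod M (U a))"
proof -
  have "word_prod M (pieces_word U) =
      word_prod M (map (\<lambda>a. word_prod M (piece_word a (U a))) [0..<K])"
    unfolding pieces_word_def using piece_word_lists U lists_S_closed
    by (intro word_prod_concat_map) auto
  also have "map (\<lambda>a. word_prod M (piece_word a (U a))) [0..<K] =
      map (\<lambda>a. local_map a (word_prod M (U a))) [0..<K]"
    using word_prod_piece_word U by auto
  finally show ?thesis
    using pieces_word_lists[of U] U lists_S_closed \<mu>_closed
    by (simp add: word_prod_append join_eq_prod)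
qed

section \<open>Left multiplication by long products over B\<close>

lemma words_pow_B_lists: "v \<in> words_pow B m \<Longrightarrow> v \<in> lists S"
  using words_pow_lists[of B S m] B LW_lists_S by blast

lemma word_cong_RL_sound:
  assumes "word_cong RL u v" "u \<in> lists S"
  shows "word_prod M u = word_prod M v"
proof -
  have "RL \<subseteq> lists (carrier M) \<times> lists (carrier M)"
    using RL(2) G(2) lists_mono by blast
  then show ?thesis
    using word_cong_sound[OF assms(1) _ RL_sound] assms(2) lists_S_closed by blast
qed

lemma LW_mult:
  assumes "u \<in> LW" "v \<in> LW"
  shows "word_prod M u \<otimes> word_prod M v \<in> word_prod M ` LW"
proof -
  obtain w where w: "w \<in> LW" "word_cong RL (u @ v) w" using LW_append assms by blast
  then have "word_prod M (u @ v) = word_prod M w"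
    using assms LW_lists_S by (intro word_cong_RL_sound) auto
  then show ?thesis
    using w assms LW_lists_S lists_S_closed by (auto simp: word_prod_append)
qed

text \<open>Values of \<open>LW\<close> are closed under products, so lengthening the prefix on the
  left never leaves them. This allows one prefix length for all generators.\<close>

lemma deep_mono:
  assumes f: "f \<in> carrier M"
    and v: "\<forall>v\<in>words_pow B m. word_prod M v \<otimes> f \<in> word_prod M ` LW"
  shows "\<forall>v\<in>words_pow B (l + m). word_prod M v \<otimes> f \<in> word_prod M ` LW"
proof (induction l)
  case (Suc l)
  show ?case
  proof
    fix v assume "v \<in> words_pow B (Suc l + m)"
    then obtain b v' where bv: "v = b @ v'" "b \<in> B" "v' \<in> words_pow B (l + m)" by auto
    then obtain w where "w \<in> LW" "word_prod M v' \<otimes> f = word_prod M w" using Suc by auto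
    moreover have "b \<in> lists (carrier M)" "v' \<in> lists (carrier M)"
      using bv B LW_lists_S lists_S_closed words_pow_B_lists by blast+
    ultimately show "word_prod M v \<otimes> f \<in> word_prod M ` LW"
      using bv B f LW_mult[of b w] by (auto simp: word_prod_append m_assoc)
  qed
qed (use v in simp)

lemma ex_depth:
  "\<exists>m. \<forall>x\<in>S. \<forall>v\<in>words_pow B (Suc m). word_prod M v \<otimes> x \<in> word_prod M ` LW"
proof -
  have "\<forall>x\<in>S. \<exists>m. \<forall>v\<in>words_pow B (Suc m). word_prod M v \<otimes> x \<in> word_prod M ` LW"
    using deep S_closed by blast
  then obtain d where d: "\<And>x. x \<in> S \<Longrightarrow>
      \<forall>v\<in>words_pow B (Suc (d x)). word_prod M v \<otimes> x \<in> word_prod M ` LW"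
    by metis
  define m where "m = Max (d ` S)"
  have "\<forall>v\<in>words_pow B (Suc m). word_prod M v \<otimes> x \<in> word_prod M ` LW" if x: "x \<in> S" for x
  proof -
    have "d x \<le> m" unfolding m_def using finite_S x by auto
    then have "(m - d x) + Suc (d x) = Suc m" by simp
    then show ?thesis
      using deep_mono[of x "Suc (d x)" "m - d x"] d[OF x] S_closed x by auto
  qed
  then show ?thesis by blast
qed

text \<open>The successor keeps the prefixes non-empty: the empty word need not be congruent to a
  normal form, whereas every product of at least one factor of B is.\<close>

definition depth :: nat where
  "depth = Suc (SOME m. \<forall>x\<in>S. \<forall>v\<in>words_pow B (Suc m). word_prod M v \<otimes> x \<in> word_prod M ` LW)"

lemma depth:
  "x \<in> S \<Longrightarrow> v \<in> words_pow B depth \<Longrightarrow> word_prod M v \<otimes> x \<in> word_prod M ` LW"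
  using someI_ex[OF ex_depth] unfolding depth_def by blast

section \<open>The defining relators and their validity\<close>

definition leaf_word :: "'a \<Rightarrow> 'a list" where
  "leaf_word y = (SOME w. w \<in> LW \<and> word_prod M w = y)"

lemma leaf_word:
  assumes "y \<in> word_prod M ` LW"
  shows "leaf_word y \<in> LW" "word_prod M (leaf_word y) = y"
proof -
  have "\<exists>w. w \<in> LW \<and> word_prod M w = y" using assms by auto
  then have "leaf_word y \<in> LW \<and> word_prod M (leaf_word y) = y"
    unfolding leaf_word_def by (rule someI_ex)
  then show "leaf_word y \<in> LW" "word_prod M (leaf_word y) = y" by auto
qed

text \<open>Role of the groups: \<open>shrink\<close>, \<open>swap a\<close> and \<theta> get their
  inverses, the last on one side only; the relators with \<mu> say that 1 is the join of the
  \<alpha> a and that x on every piece followed by \<mu> is \<mu> followed by x; local maps on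
  distinct pieces commute. The last three groups concern normal forms: \<alpha> a followed by
  \<theta> is a word of B, RL multiplies normal forms, and a prefix of \<open>depth\<close> factors
  absorbs any generator.\<close>

definition R0 :: "('a list \<times> 'a list) set" where
  "R0 = {([shrink, unshrink], []), ([unshrink, shrink], []), ([\<theta>', \<theta>], []),
      (pieces_word (\<lambda>a. [\<alpha> a]) @ [\<mu>], [])}
    \<union> (\<lambda>a. ([swap a, swap a], [])) ` {..<K}
    \<union> (\<lambda>x. (loc_word (loc_word [x]), [unshrink] @ loc_word [x] @ [shrink])) ` S
    \<union> (\<lambda>(a, b, x, y). (piece_word a [x] @ piece_word b [y], piece_word b [y] @ piece_word a [x])) `
        {(a, b, x, y). a < K \<and> b < K \<and> a \<noteq> b \<and> x \<in> S \<and> y \<in> S}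
    \<union> (\<lambda>x. (pieces_word (\<lambda>_. [x]) @ [\<mu>], [\<mu>, x])) ` S
    \<union> (\<lambda>a. ([\<alpha> a, \<theta>], leaf_word (\<alpha> a \<otimes> \<theta>))) ` {..<K}
    \<union> RL
    \<union> (\<lambda>(v, x). (v @ [x], leaf_word (word_prod M v \<otimes> x))) ` (words_pow B depth \<times> S)"

definition R :: "('a list \<times> 'a list) set" where
  "R = R0 \<union> map_prod loc_word loc_word ` R0"

lemma finite_R: "finite R"
proof -
  have "finite {(a, b, x, y). a < K \<and> b < K \<and> a \<noteq> b \<and> x \<in> S \<and> y \<in> S}"
    by (rule finite_subset[of _ "{..<K} \<times> {..<K} \<times> S \<times> S"]) (auto simp: finite_S)
  then show ?thesis
    unfolding R_def R0_def by (simp add: finite_S RL B finite_words_pow)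
qed

text \<open>\<open>leaf_word\<close> chooses within \<open>LW\<close> only; injectivity of
  evaluation on \<open>LW\<close> identifies the choice with the word of B provided by the
  assumption on \<theta>.\<close>

lemma leaf_\<alpha>_\<theta>:
  assumes a: "a < K"
  shows "leaf_word (\<alpha> a \<otimes> \<theta>) \<in> B" "word_prod M (leaf_word (\<alpha> a \<otimes> \<theta>)) = \<alpha> a \<otimes> \<theta>"
proof -
  obtain b where b: "b \<in> B" "\<alpha> a \<otimes> \<theta> = word_prod M b" using \<alpha>_\<theta>[OF a] by blast
  then have "\<alpha> a \<otimes> \<theta> \<in> word_prod M ` LW" using B by auto
  note * = leaf_word[OF this]
  show "word_prod M (leaf_word (\<alpha> a \<otimes> \<theta>)) = \<alpha> a \<otimes> \<theta>" by (rule *(2))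
  then have "leaf_word (\<alpha> a \<otimes> \<theta>) = b"
    using inj_onD[OF inj_LW, of "leaf_word (\<alpha> a \<otimes> \<theta>)" b] * b B by auto
  then show "leaf_word (\<alpha> a \<otimes> \<theta>) \<in> B" using b by simp
qed

lemma R0_sound:
  assumes "(u, v) \<in> R0"
  shows "u \<in> lists S \<and> v \<in> lists S \<and> word_prod M u = word_prod M v"
  using assms unfolding R0_def
proof (elim UnE)
  assume "(u, v) \<in> {([shrink, unshrink], []), ([unshrink, shrink], []), ([\<theta>', \<theta>], []),
      (pieces_word (\<lambda>a. [\<alpha> a]) @ [\<mu>], [])}"
  moreover have "word_prod M (pieces_word (\<lambda>a. [\<alpha> a]) @ [\<mu>]) = \<one>"
  proof -
    have "word_prod M (pieces_word (\<lambda>a. [\<alpha> a]) @ [\<mu>]) = join (\<lambda>a. word_prod M [\<alpha> a])"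
      by (intro word_prod_pieces_word) (auto simp: mem_S)
    also have "\<dots> = \<one>"
      by (rule eqI_\<alpha>) (auto simp: join_closed \<alpha>_join \<alpha>_closed)
    finally show ?thesis .
  qed
  ultimately show ?thesis
    using mem_S pieces_word_lists[of "\<lambda>a. [\<alpha> a]"] shrink_unshrink unshrink_shrink \<theta>
      shrink_closed unshrink_closed by auto
next
  assume "(u, v) \<in> (\<lambda>a. ([swap a, swap a], [])) ` {..<K}"
  then show ?thesis using mem_S swap_swap swap_closed by auto
next
  assume "(u, v) \<in> (\<lambda>x. (loc_word (loc_word [x]), [unshrink] @ loc_word [x] @ [shrink])) ` S"
  then obtain x where x: "x \<in> S" "u = loc_word (loc_word [x])"
    "v = [unshrink] @ loc_word [x] @ [shrink]" by auto
  have l: "loc_word [x] \<in> lists S" using x by (intro loc_word_lists) auto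
  have "x \<in> carrier M" using x S_closed by auto
  then show ?thesis
    using x l loc_word_lists[OF l] lists_S_closed[OF l] mem_S unshrink_closed shrink_closed
    by (simp add: word_prod_append word_prod_loc_word local_map_local_map)
next
  assume "(u, v) \<in> (\<lambda>(a, b, x, y).
      (piece_word a [x] @ piece_word b [y], piece_word b [y] @ piece_word a [x])) `
      {(a, b, x, y). a < K \<and> b < K \<and> a \<noteq> b \<and> x \<in> S \<and> y \<in> S}"
  then obtain a b x y where ab: "a < K" "b < K" "a \<noteq> b" "x \<in> S" "y \<in> S"
    and uv: "u = piece_word a [x] @ piece_word b [y]" "v = piece_word b [y] @ piece_word a [x]"
    by auto
  have "piece_word a [x] \<in> lists S" "piece_word b [y] \<in> lists S"
    using ab by (auto intro: piece_word_lists)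
  moreover have "x \<in> carrier M" "y \<in> carrier M" using ab S_closed by auto
  ultimately show ?thesis
    using ab uv lists_S_closed
    by (simp add: word_prod_append word_prod_piece_word local_map_commute)
next
  assume "(u, v) \<in> (\<lambda>x. (pieces_word (\<lambda>_. [x]) @ [\<mu>], [\<mu>, x])) ` S"
  then obtain x where x: "x \<in> S" "u = pieces_word (\<lambda>_. [x]) @ [\<mu>]" "v = [\<mu>, x]" by auto
  have xc: "x \<in> carrier M" using x S_closed by auto
  have "word_prod M u = join (\<lambda>_. word_prod M [x])"
    unfolding x(2) using x by (intro word_prod_pieces_word) auto
  also have "\<dots> = \<mu> \<otimes> x"
    using xc \<mu>_closed by - (rule eqI_\<alpha>, auto simp: \<mu>_def join_closed \<alpha>_join \<alpha>_join_mult)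
  finally show ?thesis
    using x xc mem_S pieces_word_lists[of "\<lambda>_. [x]"] \<mu>_closed by auto
next
  assume "(u, v) \<in> (\<lambda>a. ([\<alpha> a, \<theta>], leaf_word (\<alpha> a \<otimes> \<theta>))) ` {..<K}"
  then show ?thesis
    using leaf_\<alpha>_\<theta> B LW_lists_S mem_S \<theta> by auto
next
  assume "(u, v) \<in> RL"
  moreover have "lists G \<subseteq> lists S" using mem_S by (intro lists_mono) auto
  ultimately show ?thesis using RL RL_sound by auto
next
  assume "(u, v) \<in> (\<lambda>(v, x). (v @ [x], leaf_word (word_prod M v \<otimes> x))) ` (words_pow B depth \<times> S)"
  then obtain w x where w: "w \<in> words_pow B depth" "x \<in> S"
    "u = w @ [x]" "v = leaf_word (word_prod M w \<otimes> x)" by auto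
  then show ?thesis
    using depth[OF w(2,1)] leaf_word[of "word_prod M w \<otimes> x"] LW_lists_S words_pow_B_lists
      lists_S_closed S_closed by (auto simp: word_prod_append)
qed

lemma R_sound:
  assumes "(u, v) \<in> R"
  shows "u \<in> lists S" "v \<in> lists S" "word_prod M u = word_prod M v"
  using assms R0_sound loc_word_lists word_prod_loc_word unfolding R_def by auto

section \<open>The local endomorphisms of the presented monoid\<close>

abbreviation word_eq (infix "\<approx>" 50) where
  "u \<approx> v \<equiv> word_cong R u v"

lemma R0_word_eq: "(u, v) \<in> R0 \<Longrightarrow> u \<approx> v"
  by (rule word_cong.base) (simp add: R_def)

lemma word_cong_RL: "word_cong RL u v \<Longrightarrow> u \<approx> v"
  by (erule word_cong_mono) (auto simp: R_def R0_def)

lemma cancel_mid: "u \<approx> [] \<Longrightarrow> x @ u @ y \<approx> x @ y"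
  using word_cong_mid[of R u "[]" x y] by simp

lemma loc_word_loc_word:
  "w \<in> lists S \<Longrightarrow> loc_word (loc_word w) \<approx> [unshrink] @ loc_word w @ [shrink]"
proof (induction w)
  case Nil
  have "[unshrink, shrink] \<approx> []" by (rule R0_word_eq) (simp add: R0_def)
  then show ?case by (simp add: loc_word_Nil word_cong.sym)
next
  case (Cons x w)
  have su: "[shrink, unshrink] \<approx> []" by (rule R0_word_eq) (simp add: R0_def)
  have eq: "loc_word (loc_word (x # w)) = loc_word (loc_word [x]) @ loc_word (loc_word w)"
    by (simp add: loc_word_def)
  have "loc_word (loc_word [x]) \<approx> [unshrink] @ loc_word [x] @ [shrink]"
    using Cons by (intro R0_word_eq) (auto simp: R0_def)
  then have "loc_word (loc_word (x # w)) \<approx>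
      ([unshrink] @ loc_word [x] @ [shrink]) @ ([unshrink] @ loc_word w @ [shrink])"
    unfolding eq using Cons by (intro word_cong.append) auto
  also have "\<dots> = ([unshrink] @ loc_word [x]) @ [shrink, unshrink] @ (loc_word w @ [shrink])" by simp
  also have "\<dots> \<approx> ([unshrink] @ loc_word [x]) @ (loc_word w @ [shrink])" by (rule cancel_mid[OF su])
  also have "\<dots> = [unshrink] @ loc_word (x # w) @ [shrink]" by (simp add: loc_word_def)
  finally show ?case .
qed

text \<open>The relators \<open>loc_word (loc_word [x]) = unshrink loc_word [x] shrink\<close> in \<open>R0\<close> make a second
  application of \<open>loc_word\<close> a conjugation, so closing \<open>R0\<close> under \<open>loc_word\<close> once is enough.\<close>

lemma loc_word_cong: "u \<approx> v \<Longrightarrow> loc_word u \<approx> loc_word v"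
proof (induction rule: word_cong.induct)
  case (base u v)
  show ?case
  proof (cases "(u, v) \<in> R0")
    case True
    then have "(loc_word u, loc_word v) \<in> R" unfolding R_def by (auto intro: rev_image_eqI)
    then show ?thesis by (rule word_cong.base)
  next
    case False
    then obtain u' v' where uv: "(u', v') \<in> R0" "u = loc_word u'" "v = loc_word v'"
      using base unfolding R_def by auto
    have S: "u' \<in> lists S" "v' \<in> lists S" using R0_sound[OF uv(1)] by auto
    have "loc_word u \<approx> [unshrink] @ loc_word u' @ [shrink]"
      using loc_word_loc_word[OF S(1)] uv by simp
    also have "(loc_word u', loc_word v') \<in> R"
      unfolding R_def using uv(1) by (auto intro: rev_image_eqI)
    then have "[unshrink] @ loc_word u' @ [shrink] \<approx> [unshrink] @ loc_word v' @ [shrink]"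
      by (intro word_cong_mid word_cong.base)
    also have "\<dots> \<approx> loc_word v"
      using loc_word_loc_word[OF S(2)] uv by (simp add: word_cong.sym)
    finally show ?thesis .
  qed
qed (auto simp: loc_word_append intro: word_cong.intros)

lemma piece_word_cong: "u \<approx> v \<Longrightarrow> piece_word a u \<approx> piece_word a v"
  unfolding piece_word_def by (intro word_cong_mid loc_word_cong)

lemma swap_swap_word: "a < K \<Longrightarrow> [swap a, swap a] \<approx> []"
  by (rule R0_word_eq) (auto simp: R0_def)

lemma piece_word_append:
  assumes "a < K"
  shows "piece_word a (u @ v) \<approx> piece_word a u @ piece_word a v"
proof -
  have "piece_word a u @ piece_word a v =
      ([swap a] @ loc_word u) @ [swap a, swap a] @ (loc_word v @ [swap a])"
    by (simp add: piece_word_def)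
  also have "\<dots> \<approx> ([swap a] @ loc_word u) @ (loc_word v @ [swap a])"
    by (rule cancel_mid[OF swap_swap_word[OF assms]])
  also have "\<dots> = piece_word a (u @ v)" by (simp add: piece_word_def loc_word_append)
  finally show ?thesis by (rule word_cong.sym)
qed

lemma piece_word_Nil: "a < K \<Longrightarrow> piece_word a [] \<approx> []"
  using swap_swap_word by (simp add: piece_word_def loc_word_Nil)

lemma piece_word_concat:
  assumes "a < K"
  shows "piece_word a u \<approx> concat (map (\<lambda>x. piece_word a [x]) u)"
proof (induction u)
  case Nil
  then show ?case using piece_word_Nil assms by simp
next
  case (Cons x u)
  have "piece_word a ([x] @ u) \<approx> piece_word a [x] @ piece_word a u"
    by (rule piece_word_append[OF assms])
  also have "\<dots> \<approx> piece_word a [x] @ concat (map (\<lambda>x. piece_word a [x]) u)"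
    by (rule word_cong_left[OF Cons])
  finally show ?case by simp
qed

text \<open>\<open>piece_word\<close> is multiplicative up to \<approx>, so relators for pairs of
  generators settle all pairs of words.\<close>

lemma piece_word_commute:
  assumes ab: "a < K" "b < K" "a \<noteq> b" and uv: "u \<in> lists S" "v \<in> lists S"
  shows "piece_word a u @ piece_word b v \<approx> piece_word b v @ piece_word a u"
proof -
  let ?u = "concat (map (\<lambda>x. piece_word a [x]) u)" and ?v = "concat (map (\<lambda>x. piece_word b [x]) v)"
  have gen: "piece_word a [x] @ piece_word b [y] \<approx> piece_word b [y] @ piece_word a [x]"
    if "x \<in> S" "y \<in> S" for x y
  proof (rule R0_word_eq)
    have "(piece_word a [x] @ piece_word b [y], piece_word b [y] @ piece_word a [x]) \<in>
        (\<lambda>(a, b, x, y). (piece_word a [x] @ piece_word b [y], piece_word b [y] @ piece_word a [x])) `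
        {(a, b, x, y). a < K \<and> b < K \<and> a \<noteq> b \<and> x \<in> S \<and> y \<in> S}"
      using that ab by (intro image_eqI[of _ _ "(a, b, x, y)"]) auto
    then show "(piece_word a [x] @ piece_word b [y], piece_word b [y] @ piece_word a [x]) \<in> R0"
      unfolding R0_def by (simp only: Un_iff simp_thms)
  qed
  have S: "set u \<subseteq> S" "set v \<subseteq> S" using uv by (auto simp: in_lists_conv_set)
  have "piece_word a u @ piece_word b v \<approx> ?u @ ?v"
    using ab by (intro word_cong.append piece_word_concat)
  also have "\<dots> \<approx> ?v @ ?u"
  proof (rule word_cong_commute_concat)
    fix y assume y: "y \<in> set v"
    have "piece_word b [y] @ ?u \<approx> ?u @ piece_word b [y]"
      by (rule word_cong_commute_concat, rule word_cong.sym, rule gen) (use S y in auto)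
    then show "?u @ piece_word b [y] \<approx> piece_word b [y] @ ?u" by (rule word_cong.sym)
  qed
  also have "\<dots> \<approx> piece_word b v @ piece_word a u"
    using ab by (intro word_cong.append word_cong.sym[OF piece_word_concat])
  finally show ?thesis .
qed

section \<open>Joint left cancellation in the presented monoid\<close>

lemma pieces_word_cong:
  "(\<And>a. a < K \<Longrightarrow> U a \<approx> V a) \<Longrightarrow> pieces_word U \<approx> pieces_word V"
  unfolding pieces_word_def by (intro word_cong_concat_map piece_word_cong) auto

text \<open>The words for \<open>V a\<close> have to pass only words that live on other pieces,
  where they commute.\<close>

lemma pieces_word_append:
  assumes "\<And>a. a < K \<Longrightarrow> U a \<in> lists S" "\<And>a. a < K \<Longrightarrow> V a \<in> lists S"
  shows "pieces_word (\<lambda>a. U a @ V a) \<approx> pieces_word U @ pieces_word V"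
proof -
  have "pieces_word (\<lambda>a. U a @ V a) \<approx>
      concat (map (\<lambda>a. piece_word a (U a) @ piece_word a (V a)) [0..<K])"
    unfolding pieces_word_def by (intro word_cong_concat_map piece_word_append) auto
  also have "\<dots> \<approx> pieces_word U @ pieces_word V"
    unfolding pieces_word_def using assms
    by (intro word_cong_concat_append piece_word_commute) auto
  finally show ?thesis .
qed

text \<open>\<mu> forgets the piece, so doing p on every piece before it amounts to doing p after
  it.\<close>

lemma pieces_word_const:
  "p \<in> lists S \<Longrightarrow> pieces_word (\<lambda>_. p) @ [\<mu>] \<approx> [\<mu>] @ p"
proof (induction p)
  case Nil
  have "pieces_word (\<lambda>_. []) \<approx> concat (map (\<lambda>_. []) [0..<K])"
    unfolding pieces_word_def by (intro word_cong_concat_map piece_word_Nil) auto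
  also have "concat (map (\<lambda>_. []) [0..<K]) = ([] :: 'a list)" by simp
  finally show ?case using word_cong_right[of R "pieces_word (\<lambda>_. [])" "[]" "[\<mu>]"] by simp
next
  case (Cons x p)
  have x: "pieces_word (\<lambda>_. [x]) @ [\<mu>] \<approx> [\<mu>, x]"
    using Cons by (intro R0_word_eq) (auto simp: R0_def)
  have "pieces_word (\<lambda>_. [x] @ p) @ [\<mu>] \<approx> (pieces_word (\<lambda>_. [x]) @ pieces_word (\<lambda>_. p)) @ [\<mu>]"
    using Cons by (intro word_cong_right pieces_word_append) auto
  also have "\<dots> = pieces_word (\<lambda>_. [x]) @ (pieces_word (\<lambda>_. p) @ [\<mu>])" by simp
  also have "\<dots> \<approx> pieces_word (\<lambda>_. [x]) @ ([\<mu>] @ p)"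
    using Cons by (intro word_cong_left) auto
  also have "\<dots> = (pieces_word (\<lambda>_. [x]) @ [\<mu>]) @ p" by simp
  also have "\<dots> \<approx> [\<mu>, x] @ p" by (rule word_cong_right[OF x])
  finally show ?case by simp
qed

text \<open>The common right factor p splits off and leaves through \<mu>; what stays on the left is
  the relator saying that 1 is the join of the \<alpha> a.\<close>

lemma pieces_word_\<alpha>:
  assumes p: "p \<in> lists S"
  shows "pieces_word (\<lambda>a. [\<alpha> a] @ p) @ [\<mu>] \<approx> p"
proof -
  have \<alpha>: "pieces_word (\<lambda>a. [\<alpha> a]) @ [\<mu>] \<approx> []" by (rule R0_word_eq) (simp add: R0_def)
  have "pieces_word (\<lambda>a. [\<alpha> a] @ p) @ [\<mu>] \<approx>
      (pieces_word (\<lambda>a. [\<alpha> a]) @ pieces_word (\<lambda>_. p)) @ [\<mu>]"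
    using p mem_S by (intro word_cong_right pieces_word_append) auto
  also have "\<dots> = pieces_word (\<lambda>a. [\<alpha> a]) @ (pieces_word (\<lambda>_. p) @ [\<mu>])" by simp
  also have "\<dots> \<approx> pieces_word (\<lambda>a. [\<alpha> a]) @ ([\<mu>] @ p)"
    by (rule word_cong_left[OF pieces_word_const[OF p]])
  also have "\<dots> = [] @ (pieces_word (\<lambda>a. [\<alpha> a]) @ [\<mu>]) @ p" by simp
  also have "\<dots> \<approx> [] @ p" by (rule cancel_mid[OF \<alpha>])
  finally show ?thesis by simp
qed

lemma cancel_\<alpha>:
  assumes "p \<in> lists S" "q \<in> lists S" "\<And>a. a < K \<Longrightarrow> [\<alpha> a] @ p \<approx> [\<alpha> a] @ q"
  shows "p \<approx> q"
proof -
  have "p \<approx> pieces_word (\<lambda>a. [\<alpha> a] @ p) @ [\<mu>]"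
    by (rule word_cong.sym[OF pieces_word_\<alpha>[OF assms(1)]])
  also have "\<dots> \<approx> pieces_word (\<lambda>a. [\<alpha> a] @ q) @ [\<mu>]"
    by (intro word_cong_right pieces_word_cong assms(3))
  also have "\<dots> \<approx> q" by (rule pieces_word_\<alpha>[OF assms(2)])
  finally show ?thesis .
qed

text \<open>\<theta> can be cancelled because of \<theta>', and behind each \<alpha> a it becomes a
  word of B; so cancellation by the \<alpha> a carries over to B.\<close>

lemma cancel_B:
  assumes pq: "p \<in> lists S" "q \<in> lists S" and b: "\<And>b. b \<in> B \<Longrightarrow> b @ p \<approx> b @ q"
  shows "p \<approx> q"
proof -
  have \<theta>': "[\<theta>', \<theta>] \<approx> []" by (rule R0_word_eq) (simp add: R0_def)
  have "[\<theta>] @ p \<approx> [\<theta>] @ q"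
  proof (rule cancel_\<alpha>)
    fix a assume a: "a < K"
    let ?b = "leaf_word (\<alpha> a \<otimes> \<theta>)"
    have eq: "[\<alpha> a, \<theta>] \<approx> ?b"
      using a by (intro R0_word_eq) (auto simp: R0_def)
    have "[\<alpha> a, \<theta>] @ p \<approx> ?b @ p" by (rule word_cong_right[OF eq])
    also have "\<dots> \<approx> ?b @ q" by (rule b[OF leaf_\<alpha>_\<theta>(1)[OF a]])
    also have "\<dots> \<approx> [\<alpha> a, \<theta>] @ q" by (rule word_cong_right[OF word_cong.sym[OF eq]])
    finally show "[\<alpha> a] @ [\<theta>] @ p \<approx> [\<alpha> a] @ [\<theta>] @ q" by simp
  qed (use pq mem_S in auto)
  then have "[\<theta>'] @ [\<theta>] @ p \<approx> [\<theta>'] @ [\<theta>] @ q" by (rule word_cong_left)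
  then have *: "[] @ [\<theta>', \<theta>] @ p \<approx> [] @ [\<theta>', \<theta>] @ q" by simp
  have "[] @ p \<approx> [] @ [\<theta>', \<theta>] @ p" by (rule word_cong.sym[OF cancel_mid[OF \<theta>']])
  also note *
  also have "[] @ [\<theta>', \<theta>] @ q \<approx> [] @ q" by (rule cancel_mid[OF \<theta>'])
  finally show ?thesis by simp
qed

lemma cancel_words_pow:
  assumes pq: "p \<in> lists S" "q \<in> lists S"
    and v: "\<And>v. v \<in> words_pow B m \<Longrightarrow> v @ p \<approx> v @ q"
  shows "p \<approx> q"
  using v
proof (induction m)
  case 0
  then show ?case by simp
next
  case (Suc m)
  show ?case
  proof (rule Suc.IH)
    fix v assume v: "v \<in> words_pow B m"
    show "v @ p \<approx> v @ q"
    proof (rule cancel_B)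
      fix b assume "b \<in> B"
      then show "b @ v @ p \<approx> b @ v @ q" using Suc.prems[of "b @ v"] v by auto
    qed (use v words_pow_B_lists pq in auto)
  qed
qed

section \<open>Reduction to normal forms and completeness\<close>

lemma LW_word_eq:
  assumes "u \<in> LW" "v \<in> LW"
  obtains w where "w \<in> LW" "u @ v \<approx> w"
  using LW_append[OF assms] word_cong_RL by blast

lemma word_eq_sound: "u \<approx> v \<Longrightarrow> u \<in> lists S \<Longrightarrow> word_prod M u = word_prod M v"
proof -
  assume *: "u \<approx> v" "u \<in> lists S"
  have "R \<subseteq> lists (carrier M) \<times> lists (carrier M)"
    using R_sound lists_S_closed by auto
  then show ?thesis
    using word_cong_sound[OF *(1) _ R_sound(3)] *(2) lists_S_closed by blast
qed

lemma words_pow_LW: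
  "v \<in> words_pow B (Suc m) \<Longrightarrow> \<exists>w\<in>LW. v \<approx> w"
proof (induction m arbitrary: v)
  case 0
  then have "v \<in> LW" using B by auto
  then show ?case by (blast intro: word_cong.refl)
next
  case (Suc m)
  from Suc.prems obtain b v' where v: "v = b @ v'" "b \<in> B" "v' \<in> words_pow B (Suc m)"
    unfolding words_pow.simps(2)[of B "Suc m"] by auto
  then obtain w where w: "w \<in> LW" "v' \<approx> w" using Suc.IH by blast
  obtain w' where w': "w' \<in> LW" "b @ w \<approx> w'" using LW_word_eq v B w by blast
  have "v \<approx> w'" unfolding v(1) using word_cong_left[OF w(2)] w'(2) by (rule word_cong.trans)
  then show ?case using w' by blast
qed

text \<open>A prefix of m factors of B is moved through a normal form: the product is factored anew
  so that m factors of B stand last, next to the generator that they are to absorb.\<close>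

lemma words_pow_past_LW:
  assumes "v \<in> words_pow B m" "u \<in> LW"
  shows "\<exists>l\<in>LW. \<exists>v'\<in>words_pow B m. word_prod M (v @ u) = word_prod M (l @ v')"
  using assms
proof (induction m arbitrary: v)
  case 0
  then show ?case by auto
next
  case (Suc m)
  from Suc.prems obtain b v1 where v: "v = b @ v1" "b \<in> B" "v1 \<in> words_pow B m" by auto
  then obtain l v' where l: "l \<in> LW" "v' \<in> words_pow B m"
    "word_prod M (v1 @ u) = word_prod M (l @ v')" using Suc by blast
  obtain l' b' where l': "l' \<in> LW" "b' \<in> B" "word_prod M (b @ l) = word_prod M (l' @ b')"
    using B_LW[OF v(2) l(1)] by blast
  have C: "x \<in> lists (carrier M)" if "x \<in> LW \<or> x \<in> B \<or> x \<in> words_pow B m" for x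
    using that B LW_lists_S lists_S_closed words_pow_B_lists by blast
  have "word_prod M (v @ u) = word_prod M b \<otimes> word_prod M (v1 @ u)"
    using v C Suc.prems by (simp add: word_prod_append m_assoc)
  also have "\<dots> = word_prod M (b @ l) \<otimes> word_prod M v'"
    using l v C by (simp add: word_prod_append m_assoc)
  also have "\<dots> = word_prod M (l' @ (b' @ v'))"
    unfolding l'(3) using l l' C by (simp add: word_prod_append m_assoc)
  finally show ?case using l l' by auto
qed

text \<open>Every further letter of q costs \<open>depth\<close> more factors in the prefix. The
  factor u starts the induction, as the empty word need not be a normal form.\<close>

lemma ex_leaf_form:
  assumes "q \<in> lists S"
  shows "\<exists>l. \<forall>u\<in>LW. \<forall>v\<in>words_pow B l. \<exists>w\<in>LW. v @ u @ q \<approx> w"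
  using assms
proof (induction q rule: rev_induct)
  case Nil
  show ?case by (rule exI[of _ 0]) (auto intro: word_cong.refl)
next
  case (snoc x q)
  then obtain l where l: "\<And>u v. u \<in> LW \<Longrightarrow> v \<in> words_pow B l \<Longrightarrow> \<exists>w\<in>LW. v @ u @ q \<approx> w"
    by auto
  have x: "x \<in> S" using snoc by simp
  have "\<exists>w\<in>LW. v @ u @ q @ [x] \<approx> w" if u: "u \<in> LW" and v: "v \<in> words_pow B (depth + l)" for u v
  proof -
    obtain v2 v1 where v12: "v = v2 @ v1" "v2 \<in> words_pow B depth" "v1 \<in> words_pow B l"
      using words_pow_add[OF v] by blast
    obtain w where w: "w \<in> LW" "v1 @ u @ q \<approx> w" using l[OF u v12(3)] by blast
    obtain w' v' where w': "w' \<in> LW" "v' \<in> words_pow B depth"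
      "word_prod M (v2 @ w) = word_prod M (w' @ v')"
      using words_pow_past_LW[OF v12(2) w(1)] by blast
    obtain c where c: "c \<in> LW" "v2 \<approx> c"
      using words_pow_LW v12(2) unfolding depth_def by blast
    obtain c' where c': "c' \<in> LW" "v' \<approx> c'"
      using words_pow_LW w'(2) unfolding depth_def by blast
    obtain d where d: "d \<in> LW" "c @ w \<approx> d" using LW_word_eq c w by blast
    obtain d' where d': "d' \<in> LW" "w' @ c' \<approx> d'" using LW_word_eq c' w' by blast
    have 1: "v2 @ w \<approx> d" using word_cong_right[OF c(2)] d(2) by (rule word_cong.trans)
    have 2: "w' @ v' \<approx> d'" using word_cong_left[OF c'(2)] d'(2) by (rule word_cong.trans)
    \<comment> \<open>Both factorisations reduce to normal forms by relators. Their values agree, so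
      the normal forms are the same word, and the equality of values becomes a congruence.\<close>
    have "word_prod M d = word_prod M d'"
      using word_eq_sound[OF 1] word_eq_sound[OF 2] w'(3) v12 w w' LW_lists_S words_pow_B_lists
      by auto
    then have "d = d'" using inj_onD[OF inj_LW] d d' by blast
    let ?e = "leaf_word (word_prod M v' \<otimes> x)"
    have e: "?e \<in> LW" using leaf_word(1)[OF depth[OF x w'(2)]] .
    have ve: "v' @ [x] \<approx> ?e"
      using w'(2) x by (intro R0_word_eq) (auto simp: R0_def)
    obtain z where z: "z \<in> LW" "w' @ ?e \<approx> z" using LW_word_eq[OF w'(1) e] by blast
    have "v @ u @ q @ [x] = v2 @ (v1 @ u @ q) @ [x]" using v12 by simp
    also have "\<dots> \<approx> v2 @ w @ [x]" by (rule word_cong_mid[OF w(2)])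
    also have "\<dots> = (v2 @ w) @ [x]" by simp
    also have "\<dots> \<approx> d @ [x]" by (rule word_cong_right[OF 1])
    also have "\<dots> \<approx> (w' @ v') @ [x]"
      unfolding \<open>d = d'\<close> by (rule word_cong_right[OF word_cong.sym[OF 2]])
    also have "\<dots> = w' @ (v' @ [x])" by simp
    also have "\<dots> \<approx> w' @ ?e" by (rule word_cong_left[OF ve])
    also have "\<dots> \<approx> z" by (rule z(2))
    finally show ?thesis using z(1) by blast
  qed
  then show ?case by (intro exI[of _ "depth + l"]) simp
qed

text \<open>The bound is made stable under longer prefixes, so that two words can be given a common
  one.\<close>

lemma ex_leaf_form':
  assumes q: "q \<in> lists S"
  shows "\<exists>l. \<forall>l'. \<forall>v\<in>words_pow B (l' + l). \<exists>w\<in>LW. v @ q \<approx> w"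
proof -
  obtain l where l: "\<And>u v. u \<in> LW \<Longrightarrow> v \<in> words_pow B l \<Longrightarrow> \<exists>w\<in>LW. v @ u @ q \<approx> w"
    using ex_leaf_form[OF q] by blast
  \<comment> \<open>The additional factor of B plays the part of u in
    \<open>ex_leaf_form\<close>.\<close>
  have "\<exists>w\<in>LW. v @ q \<approx> w" if v: "v \<in> words_pow B (l' + (l + 1))" for l' v
    using v
  proof (induction l' arbitrary: v)
    case 0
    then have "v \<in> words_pow B (l + 1)" by simp
    then obtain v1 b where "v = v1 @ b" "v1 \<in> words_pow B l" "b \<in> words_pow B 1"
      by (rule words_pow_add)
    moreover from this have "b \<in> B" by auto
    ultimately show ?case using l[of b v1] B by auto
  next
    case (Suc l')
    then obtain b v' where v: "v = b @ v'" "b \<in> B" "v' \<in> words_pow B (l' + (l + 1))" by auto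
    then obtain w where w: "w \<in> LW" "v' @ q \<approx> w" using Suc.IH by blast
    obtain z where z: "z \<in> LW" "b @ w \<approx> z" using LW_word_eq v B w by blast
    have "b @ v' @ q \<approx> z" using word_cong_left[OF w(2)] z(2) by (rule word_cong.trans)
    then show ?case using v z by auto
  qed
  then show ?thesis by blast
qed

lemma word_eq_complete:
  assumes pq: "p \<in> lists S" "q \<in> lists S" and eq: "word_prod M p = word_prod M q"
  shows "p \<approx> q"
proof -
  obtain l where l: "\<And>l' v. v \<in> words_pow B (l' + l) \<Longrightarrow> \<exists>w\<in>LW. v @ p \<approx> w"
    using ex_leaf_form'[OF pq(1)] by blast
  obtain m where m: "\<And>l' v. v \<in> words_pow B (l' + m) \<Longrightarrow> \<exists>w\<in>LW. v @ q \<approx> w"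
    using ex_leaf_form'[OF pq(2)] by blast
  show ?thesis
  proof (rule cancel_words_pow[OF pq])
    fix v assume v: "v \<in> words_pow B (m + l)"
    obtain w where w: "w \<in> LW" "v @ p \<approx> w" using l[OF v] by blast
    obtain z where z: "z \<in> LW" "v @ q \<approx> z" using m[of v l] v by (auto simp: add.commute)
    have vS: "v \<in> lists S" using words_pow_B_lists v by blast
    have "word_prod M w = word_prod M z"
      using word_eq_sound[OF w(2)] word_eq_sound[OF z(2)] vS pq eq lists_S_closed
      by (simp add: word_prod_append)
    then have "w = z" using inj_onD[OF inj_LW] w z by blast
    then show "v @ p \<approx> v @ q" using w z by (blast intro: word_cong.trans word_cong.sym)
  qed
qed

theorem finitely_presented: "finitely_presented_monoid M"
proof (rule finitely_presented_monoidI)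
  show "monoid M" by (rule monoid_axioms)
  show "R \<subseteq> lists S \<times> lists S" using R_sound by auto
  show "word_prod M u = word_prod M v" if "(u, v) \<in> R" for u v using R_sound[OF that] by simp
qed (use finite_S S_closed finite_R carrier_generated word_eq_complete in auto)

end

section \<open>The monoid of pseudotree pairs\<close>

text \<open>One constant tail does not suffice: the empty word and a run of a's agree once followed
  by a's. A difference in length is filled with the letter of the tail, which cannot be both a and
  b.\<close>

lemma shift_eq_shift_imp_eq:
  assumes ab: "a \<noteq> b" and s: "s @- sconst a = t @- sconst a" "s @- sconst b = t @- sconst b"
  shows "s = t"
proof -
  have *: "u = v" if "length u \<le> length v" "u @- sconst a = v @- sconst a"
    "u @- sconst b = v @- sconst b" for u v
  proof -
    have u: "v = u @ replicate (length v - length u) c" if "u @- sconst c = v @- sconst c" for c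
    proof -
      have "v = stake (length v) (u @- sconst c)" using that by (simp add: stake_shift)
      also have "\<dots> = u @ replicate (length v - length u) c"
        using \<open>length u \<le> length v\<close> by (simp add: stake_shift map_replicate_const)
      finally show ?thesis .
    qed
    have "replicate (length v - length u) a = replicate (length v - length u) b"
      using u[OF that(2)] u[OF that(3)] by (metis same_append_eq)
    then have "length v - length u = 0" using ab by (cases "length v - length u") auto
    then show ?thesis using u[OF that(2)] by simp
  qed
  show ?thesis using *[of s t] *[of t s] s by (cases "length s \<le> length t") auto
qed

lemma stake_lists: "y \<in> streams A \<Longrightarrow> stake N y \<in> lists A"
  by (induction N arbitrary: y) (auto simp: streams_shd streams_stl)

lemma sdrop_streams: "y \<in> streams A \<Longrightarrow> sdrop N y \<in> streams A"
  by (induction N arbitrary: y) (auto simp: streams_stl)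

locale tot_monoid =
  fixes n k r :: nat
  assumes r: "r \<ge> 1" and n: "n \<ge> 1" and k: "k \<ge> 2"
begin

abbreviation "W \<equiv> fin_words n k"
abbreviation "Y \<equiv> inf_words n k"
abbreviation "X \<equiv> Cantor n k r"
abbreviation "TM \<equiv> totM n k r"

section \<open>Tuples of words and splitting at a fixed length\<close>

definition fcat :: "(nat \<Rightarrow> nat list) \<Rightarrow> (nat \<Rightarrow> nat list) \<Rightarrow> nat \<Rightarrow> nat list" where
  "fcat s t = (\<lambda>i\<in>{..<n}. s i @ t i)"

definition cat :: "(nat \<Rightarrow> nat list) \<Rightarrow> (nat \<Rightarrow> nat stream) \<Rightarrow> nat \<Rightarrow> nat stream" where
  "cat s y = (\<lambda>i\<in>{..<n}. s i @- y i)"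

lemma dot_inf_eq: "dot_inf n d y = (fst d, cat (snd d) y)"
  by (simp add: dot_inf_def cat_def)

definition wl :: "nat \<Rightarrow> (nat \<Rightarrow> nat list) set" where
  "wl N = {..<n} \<rightarrow>\<^sub>E {s. set s \<subseteq> {..<k} \<and> length s = N}"

definition head :: "nat \<Rightarrow> (nat \<Rightarrow> nat stream) \<Rightarrow> nat \<Rightarrow> nat list" where
  "head N y = (\<lambda>i\<in>{..<n}. stake N (y i))"

definition tail :: "nat \<Rightarrow> (nat \<Rightarrow> nat stream) \<Rightarrow> nat \<Rightarrow> nat stream" where
  "tail N y = (\<lambda>i\<in>{..<n}. sdrop N (y i))"

lemma mem_X: "p \<in> X \<longleftrightarrow> fst p < r \<and> snd p \<in> Y"
  by (cases p) (auto simp: Cantor_def)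

lemma mem_nT: "d \<in> nT n k r \<longleftrightarrow> fst d < r \<and> snd d \<in> W"
  by (cases d) (auto simp: nT_def)

lemma mem_W: "s \<in> W \<longleftrightarrow> s \<in> extensional {..<n} \<and> (\<forall>i<n. s i \<in> lists {..<k})"
  by (auto simp: fin_words_def PiE_def Pi_def)

lemma mem_Y: "y \<in> Y \<longleftrightarrow> y \<in> extensional {..<n} \<and> (\<forall>i<n. y i \<in> streams {..<k})"
  by (auto simp: inf_words_def PiE_def Pi_def)

lemma mem_wl: "s \<in> wl N \<longleftrightarrow> s \<in> W \<and> (\<forall>i<n. length (s i) = N)"
  by (auto simp: wl_def mem_W PiE_def Pi_def in_lists_conv_set)

lemma cat_closed: "s \<in> W \<Longrightarrow> y \<in> Y \<Longrightarrow> cat s y \<in> Y"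
  by (auto simp: mem_W mem_Y cat_def shift_streams)

lemma fcat_closed: "s \<in> W \<Longrightarrow> t \<in> W \<Longrightarrow> fcat s t \<in> W"
  by (auto simp: mem_W fcat_def)

lemma fcat_wl: "s \<in> wl N \<Longrightarrow> t \<in> wl N' \<Longrightarrow> fcat s t \<in> wl (N + N')"
  by (auto simp: mem_wl fcat_closed) (simp add: fcat_def)

lemma cat_fcat: "cat (fcat s t) y = cat s (cat t y)"
  by (auto simp: cat_def fcat_def)

lemma head_wl: "y \<in> Y \<Longrightarrow> head N y \<in> wl N"
  by (auto simp: mem_Y mem_wl mem_W head_def stake_lists)

lemma tail_closed: "y \<in> Y \<Longrightarrow> tail N y \<in> Y"
  by (auto simp: mem_Y tail_def sdrop_streams)

lemma cat_head_tail: "y \<in> Y \<Longrightarrow> cat (head N y) (tail N y) = y"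
  by (rule ext) (auto simp: mem_Y cat_def head_def tail_def stake_sdrop extensional_def)

lemma head_cat: "s \<in> wl N \<Longrightarrow> y \<in> Y \<Longrightarrow> head N (cat s y) = s"
  by (rule ext) (auto simp: mem_wl mem_W cat_def head_def stake_shift extensional_def)

lemma tail_cat: "s \<in> wl N \<Longrightarrow> y \<in> Y \<Longrightarrow> tail N (cat s y) = y"
  by (rule ext) (auto simp: mem_wl mem_Y cat_def tail_def sdrop_shift extensional_def)

lemma split_word:
  assumes s: "s \<in> W" "\<And>i. i < n \<Longrightarrow> N \<le> length (s i)"
  obtains s1 s2 where "s1 \<in> wl N" "s2 \<in> W" "s = fcat s1 s2"
    "\<And>i. i < n \<Longrightarrow> length (s2 i) = length (s i) - N"
proof
  let ?s1 = "\<lambda>i\<in>{..<n}. take N (s i)" and ?s2 = "\<lambda>i\<in>{..<n}. drop N (s i)"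
  show "?s1 \<in> wl N" "?s2 \<in> W"
    using s by (auto simp: mem_wl mem_W in_lists_conv_set dest: in_set_takeD in_set_dropD)
  show "s = fcat ?s1 ?s2"
    using s by (intro ext) (auto simp: fcat_def mem_W extensional_def)
  show "length (?s2 i) = length (s i) - N" if "i < n" for i using that by simp
qed

lemma split_wl:
  assumes s: "s \<in> wl (N + N')"
  obtains s1 s2 where "s1 \<in> wl N" "s2 \<in> wl N'" "s = fcat s1 s2"
proof -
  have "s \<in> W" "N \<le> length (s i)" if "i < n" for i using s that by (auto simp: mem_wl)
  then obtain s1 s2 where s12: "s1 \<in> wl N" "s2 \<in> W" "s = fcat s1 s2"
    "\<And>i. i < n \<Longrightarrow> length (s2 i) = length (s i) - N"
    using split_word[of s N] n by (metis less_le_trans zero_less_one)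
  then have "s2 \<in> wl N'" using s by (simp add: mem_wl)
  then show ?thesis using s12 that by blast
qed

definition const :: "nat \<Rightarrow> nat \<Rightarrow> nat stream" where
  "const a = (\<lambda>i\<in>{..<n}. sconst a)"

lemma const_closed: "a < k \<Longrightarrow> const a \<in> Y"
  by (auto simp: mem_Y const_def streams_iff_sset)

lemma cat_inject:
  assumes st: "s \<in> W" "t \<in> W" and eq: "\<And>y. y \<in> Y \<Longrightarrow> cat s y = cat t y"
  shows "s = t"
proof
  fix i
  show "s i = t i"
  proof (cases "i < n")
    case True
    have "s i @- sconst a = t i @- sconst a" if "a < k" for a
      using fun_cong[OF eq[OF const_closed[OF that]], of i] True by (simp add: cat_def const_def)
    from this[of 0] this[of 1] show ?thesis
      using k by (intro shift_eq_shift_imp_eq[of 0 1]) auto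
  next
    case False
    then show ?thesis using st by (auto simp: mem_W extensional_def)
  qed
qed

section \<open>Prefix replacement at uniform depth\<close>

definition level :: "nat \<Rightarrow> (nat \<times> (nat \<Rightarrow> nat stream) \<Rightarrow> nat \<times> (nat \<Rightarrow> nat stream)) \<Rightarrow> bool" where
  "level N f \<longleftrightarrow> (\<forall>m<r. \<forall>s\<in>wl N. \<exists>e\<in>nT n k r. \<forall>y\<in>Y. f (m, cat s y) = dot_inf n e y)"

lemma level_add:
  assumes "level N f"
  shows "level (N + N') f"
  unfolding level_def
proof (intro allI impI ballI)
  fix m s assume m: "m < r" and s: "s \<in> wl (N + N')"
  obtain s1 s2 where s12: "s1 \<in> wl N" "s2 \<in> wl N'" "s = fcat s1 s2" by (rule split_wl[OF s])
  obtain e where e: "e \<in> nT n k r" "\<And>y. y \<in> Y \<Longrightarrow> f (m, cat s1 y) = dot_inf n e y"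
    using assms m s12 unfolding level_def by blast
  have "f (m, cat s y) = dot_inf n (fst e, fcat (snd e) s2) y" if "y \<in> Y" for y
    using e(2)[OF cat_closed[OF _ that]] s12 by (simp add: mem_wl cat_fcat dot_inf_eq)
  moreover have "(fst e, fcat (snd e) s2) \<in> nT n k r"
    using e s12 by (simp add: mem_nT mem_wl fcat_closed)
  ultimately show "\<exists>e\<in>nT n k r. \<forall>y\<in>Y. f (m, cat s y) = dot_inf n e y" by blast
qed

lemma level_mono: "level N f \<Longrightarrow> N \<le> N' \<Longrightarrow> level N' f"
  using level_add[of N f "N' - N"] by simp

definition truncated :: "nat \<Rightarrow> (nat \<times> (nat \<Rightarrow> nat list)) set" where
  "truncated N = {d \<in> nT n k r. \<forall>i<n. length (snd d i) \<le> N}"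

lemma finite_truncated: "finite (truncated N)"
proof (rule finite_subset)
  show "truncated N \<subseteq> {..<r} \<times> ({..<n} \<rightarrow>\<^sub>E {s. set s \<subseteq> {..<k} \<and> length s \<le> N})"
    by (auto simp: truncated_def mem_nT mem_W PiE_def Pi_def in_lists_conv_set)
  show "finite ({..<r} \<times> ({..<n} \<rightarrow>\<^sub>E {s. set s \<subseteq> {..<k} \<and> length s \<le> N}))"
    by (intro finite_cartesian_product finite_PiE finite_lists_length_le) auto
qed

lemma Leaves_truncated: "Leaves n k (truncated N) = {..<r} \<times> wl N"
proof (intro equalityI subsetI)
  fix d assume d: "d \<in> Leaves n k (truncated N)"
  then have dW: "fst d < r" "snd d \<in> W" and len: "\<And>i. i < n \<Longrightarrow> length (snd d i) \<le> N"
    by (auto simp: Leaves_def truncated_def mem_nT)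
  \<comment> \<open>Pads every coordinate up to length N; a maximal element cannot grow, so the
    padding is empty.\<close>
  define t where "t = (\<lambda>i\<in>{..<n}. replicate (N - length (snd d i)) (0 :: nat))"
  have t: "t \<in> W" using k by (auto simp: t_def mem_W in_lists_conv_set)
  have "dot_fin n d t = (fst d, fcat (snd d) t)" by (simp add: dot_fin_def fcat_def)
  then have "dot_fin n d t \<in> truncated N"
    using dW t len by (auto simp: truncated_def mem_nT fcat_closed) (simp add: fcat_def t_def)
  then have "dot_fin n d t = d"
    using d t unfolding Leaves_def nT_le_def by blast
  then have eq: "snd (dot_fin n d t) i = snd d i" for i by simp
  have "length (snd d i) = N" if "i < n" for i
    using eq[of i] that len[OF that] by (simp add: dot_fin_def t_def)
  with dW show "d \<in> {..<r} \<times> wl N" by (cases d) (auto simp: mem_wl)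
next
  fix d assume d: "d \<in> {..<r} \<times> wl N"
  then have dW: "fst d < r" "snd d \<in> W" "\<And>i. i < n \<Longrightarrow> length (snd d i) = N"
    by (auto simp: mem_wl)
  have "u = d" if u: "u \<in> truncated N" "nT_le n k d u" for u
  proof -
    obtain t where t: "t \<in> W" "u = dot_fin n d t" using u unfolding nT_le_def by blast
    have "snd u i = snd d i" for i
    proof (cases "i < n")
      case True
      then show ?thesis using u(1) t dW(3)[OF True] by (auto simp: truncated_def dot_fin_def)
    next
      case False
      then show ?thesis using t dW by (auto simp: mem_W dot_fin_def extensional_def)
    qed
    moreover have "fst u = fst d" using t by (simp add: dot_fin_def)
    ultimately show ?thesis by (auto simp: prod_eq_iff)
  qed
  then show "d \<in> Leaves n k (truncated N)"
    using dW by (auto simp: Leaves_def truncated_def mem_nT)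
qed

lemma pseudotree_truncated: "pseudotree n k r (truncated N)"
  unfolding pseudotree_def
proof (intro conjI ballI impI)
  show "finite (truncated N)" by (rule finite_truncated)
  show "truncated N \<subseteq> nT n k r" by (auto simp: truncated_def)
next
  fix v u assume v: "v \<in> truncated N" and u: "u \<in> nT n k r" and "nT_le n k u v"
  then obtain t where "v = dot_fin n u t" unfolding nT_le_def by blast
  then show "u \<in> truncated N" using v u by (auto simp: truncated_def dot_fin_def)
next
  \<comment> \<open>A cone of depth N is a fibre of the map that takes the copy index and the first
    N letters, and fibres partition the space.\<close>
  have cone: "cone n k d = {p \<in> X. fst p = fst d \<and> head N (snd p) = snd d}"
    if d: "d \<in> {..<r} \<times> wl N" for d
  proof (intro equalityI subsetI)
    fix p assume "p \<in> cone n k d"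
    then show "p \<in> {p \<in> X. fst p = fst d \<and> head N (snd p) = snd d}"
      using d by (auto simp: cone_def dot_inf_eq mem_X head_cat cat_closed mem_wl)
  next
    fix p assume p: "p \<in> {p \<in> X. fst p = fst d \<and> head N (snd p) = snd d}"
    then have "p = dot_inf n d (tail N (snd p))"
      using cat_head_tail[of "snd p" N] by (auto simp: dot_inf_eq mem_X prod_eq_iff)
    then show "p \<in> cone n k d" using p by (auto simp: cone_def mem_X tail_closed)
  qed
  have ne: "cone n k d \<noteq> {}" for d using const_closed[of 0] k by (auto simp: cone_def)
  show "partition_on X (cone n k ` Leaves n k (truncated N))"
    unfolding Leaves_truncated
  proof (rule partition_onI)
    show "\<Union> (cone n k ` ({..<r} \<times> wl N)) = X"
    proof (intro equalityI subsetI)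
      fix p assume "p \<in> \<Union> (cone n k ` ({..<r} \<times> wl N))"
      then show "p \<in> X" using cone by auto
    next
      fix p assume p: "p \<in> X"
      then have "(fst p, head N (snd p)) \<in> {..<r} \<times> wl N" by (auto simp: mem_X head_wl)
      moreover from cone[OF this] p have "p \<in> cone n k (fst p, head N (snd p))" by auto
      ultimately show "p \<in> \<Union> (cone n k ` ({..<r} \<times> wl N))" by blast
    qed
    fix P Q assume PQ: "P \<in> cone n k ` ({..<r} \<times> wl N)" "Q \<in> cone n k ` ({..<r} \<times> wl N)" "P \<noteq> Q"
    then obtain d e where de: "d \<in> {..<r} \<times> wl N" "e \<in> {..<r} \<times> wl N"
      and P: "P = cone n k d" "Q = cone n k e" by blast
    have "d \<noteq> e" using PQ P by auto
    then show "disjnt P Q" unfolding P cone[OF de(1)] cone[OF de(2)] disjnt_def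
      by (auto simp: prod_eq_iff)
  qed (use ne in auto)
qed

text \<open>A finite tree has a bound N on all its word lengths, and every tuple of words of length
  N then extends some leaf and inherits its prefix replacement. Conversely the tree of all words of
  length at most N has exactly the leaves that a level asks for.\<close>

lemma mem_carrier:
  "f \<in> carrier TM \<longleftrightarrow> f \<in> X \<rightarrow>\<^sub>E X \<and> (\<exists>N. level N f)"
proof
  assume "f \<in> carrier TM"
  then obtain D h where D: "pseudotree n k r D" and h: "h \<in> Leaves n k D \<rightarrow> nT n k r"
    and f: "f \<in> X \<rightarrow>\<^sub>E X"
    and fh: "\<And>d y. d \<in> Leaves n k D \<Longrightarrow> y \<in> Y \<Longrightarrow> f (dot_inf n d y) = dot_inf n (h d) y"
    by (auto simp: totM_def pseudotree_pair_def represents_def)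
  have D': "finite D" "D \<subseteq> nT n k r" "\<Union> (cone n k ` Leaves n k D) = X"
    using D by (auto simp: pseudotree_def partition_on_def)
  have "finite ((\<lambda>(d, i). length (snd d i)) ` (D \<times> {..<n}))" using D' by auto
  then obtain N where "\<forall>l \<in> (\<lambda>(d, i). length (snd d i)) ` (D \<times> {..<n}). l \<le> N"
    unfolding finite_nat_set_iff_bounded_le by blast
  then have N: "length (snd d i) \<le> N" if "d \<in> D" "i < n" for d i
    using that by fastforce
  have "level N f"
    unfolding level_def
  proof (intro allI impI ballI)
    fix m s assume m: "m < r" and s: "s \<in> wl N"
    \<comment> \<open>A sample point of the cone under s: the leaf whose cone contains it must be a
      prefix of s, since no coordinate of a leaf is longer than N.\<close>
    have "(m, cat s (const 0)) \<in> X"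
      using m s k by (auto simp: mem_X mem_wl cat_closed const_closed)
    then obtain d t where d: "d \<in> Leaves n k D" and t: "t \<in> Y"
      and eq: "(m, cat s (const 0)) = dot_inf n d t"
      using D'(3) unfolding cone_def by blast
    have dD: "d \<in> D" using d by (simp add: Leaves_def)
    define u where "u = (\<lambda>i\<in>{..<n}. drop (length (snd d i)) (s i))"
    have u: "u \<in> W"
      using s by (auto simp: u_def mem_wl mem_W in_lists_conv_set dest: in_set_dropD)
    have "s i = snd d i @ u i" if i: "i < n" for i
    proof -
      have "cat s (const 0) = cat (snd d) t" using eq by (simp add: dot_inf_eq)
      from fun_cong[OF this, of i] i have "s i @- sconst 0 = snd d i @- t i"
        by (simp add: cat_def const_def)
      then have "stake (length (snd d i)) (s i @- sconst 0) = snd d i"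
        by (simp add: stake_shift)
      moreover have "length (snd d i) \<le> length (s i)"
        using N[OF dD i] s i by (simp add: mem_wl)
      ultimately have "take (length (snd d i)) (s i) = snd d i"
        by (simp add: stake_shift)
      then show ?thesis using i by (simp add: u_def) (metis append_take_drop_id)
    qed
    then have su: "s = fcat (snd d) u"
      using s by (intro ext) (auto simp: fcat_def mem_wl mem_W extensional_def)
    have md: "m = fst d" using eq by (simp add: dot_inf_eq)
    have hd: "h d \<in> nT n k r" using h d by blast
    have "f (m, cat s y) = dot_inf n (fst (h d), fcat (snd (h d)) u) y" if y: "y \<in> Y" for y
      using fh[OF d cat_closed[OF u y]] by (simp add: dot_inf_eq md su cat_fcat)
    moreover have "(fst (h d), fcat (snd (h d)) u) \<in> nT n k r"
      using hd u by (simp add: mem_nT fcat_closed)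
    ultimately show "\<exists>e\<in>nT n k r. \<forall>y\<in>Y. f (m, cat s y) = dot_inf n e y" by blast
  qed
  then show "f \<in> X \<rightarrow>\<^sub>E X \<and> (\<exists>N. level N f)" using f by blast
next
  assume "f \<in> X \<rightarrow>\<^sub>E X \<and> (\<exists>N. level N f)"
  then obtain N where f: "f \<in> X \<rightarrow>\<^sub>E X" and N: "level N f" by blast
  have "\<forall>d\<in>{..<r} \<times> wl N. \<exists>e. e \<in> nT n k r \<and> (\<forall>y\<in>Y. f (dot_inf n d y) = dot_inf n e y)"
  proof
    fix d assume "d \<in> {..<r} \<times> wl N"
    then have "fst d < r" "snd d \<in> wl N" by auto
    then obtain e where "e \<in> nT n k r" "\<forall>y\<in>Y. f (fst d, cat (snd d) y) = dot_inf n e y"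
      using N unfolding level_def by blast
    then show "\<exists>e. e \<in> nT n k r \<and> (\<forall>y\<in>Y. f (dot_inf n d y) = dot_inf n e y)"
      unfolding dot_inf_eq[of d] by blast
  qed
  from bchoice[OF this] obtain h where "\<forall>d\<in>{..<r} \<times> wl N.
      h d \<in> nT n k r \<and> (\<forall>y\<in>Y. f (dot_inf n d y) = dot_inf n (h d) y)"
    by blast
  then have "pseudotree_pair n k r (truncated N) h \<and> represents n k r (truncated N) h f"
    using f pseudotree_truncated
    unfolding pseudotree_pair_def represents_def Leaves_truncated by blast
  then show "f \<in> carrier TM" by (auto simp: totM_def)
qed

section \<open>The monoid structure; shifts, copies and leaf maps\<close>

lemma carrier_apply: "f \<in> carrier TM \<Longrightarrow> p \<in> X \<Longrightarrow> f p \<in> X"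
  by (auto simp: mem_carrier)

lemma mult_apply: "p \<in> X \<Longrightarrow> (f \<otimes>\<^bsub>TM\<^esub> g) p = g (f p)"
  by (simp add: totM_def compose_def)

lemma one_apply: "p \<in> X \<Longrightarrow> \<one>\<^bsub>TM\<^esub> p = p"
  by (simp add: totM_def)

lemma carrier_eqI:
  "f \<in> carrier TM \<Longrightarrow> g \<in> carrier TM \<Longrightarrow> (\<And>p. p \<in> X \<Longrightarrow> f p = g p) \<Longrightarrow> f = g"
  unfolding mem_carrier by (rule PiE_ext[of _ X "\<lambda>_. X"]) blast+

lemma mult_carrier:
  assumes f: "f \<in> carrier TM" and g: "g \<in> carrier TM"
  shows "f \<otimes>\<^bsub>TM\<^esub> g \<in> carrier TM"
proof -
  obtain N N' where N: "level N f" "level N' g" using f g by (auto simp: mem_carrier)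
  have "level (N + N') (f \<otimes>\<^bsub>TM\<^esub> g)"
    unfolding level_def
  proof (intro allI impI ballI)
    fix m s assume m: "m < r" and s: "s \<in> wl (N + N')"
    obtain s1 s2 where s12: "s1 \<in> wl N" "s2 \<in> wl N'" "s = fcat s1 s2" by (rule split_wl[OF s])
    obtain e where e: "e \<in> nT n k r" "\<And>y. y \<in> Y \<Longrightarrow> f (m, cat s1 y) = dot_inf n e y"
      using N(1) m s12(1) unfolding level_def by blast
    have es: "fcat (snd e) s2 \<in> W" using e s12 by (simp add: mem_nT mem_wl fcat_closed)
    \<comment> \<open>The N' letters of \<open>s2\<close> survive behind the new prefix, so g always
      finds enough letters. This is why the levels add.\<close>
    have len: "N' \<le> length (fcat (snd e) s2 i)" if "i < n" for i
      using that s12 by (simp add: fcat_def mem_wl)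
    obtain t1 t2 where t: "t1 \<in> wl N'" "t2 \<in> W" "fcat (snd e) s2 = fcat t1 t2"
      by (rule split_word[OF es len]) blast+
    have "fst e < r" using e(1) by (simp add: mem_nT)
    then obtain e' where e': "e' \<in> nT n k r"
      "\<And>y. y \<in> Y \<Longrightarrow> g (fst e, cat t1 y) = dot_inf n e' y"
      using N(2) t(1) unfolding level_def by blast
    have "(f \<otimes>\<^bsub>TM\<^esub> g) (m, cat s y) = dot_inf n (fst e', fcat (snd e') t2) y" if y: "y \<in> Y" for y
    proof -
      have s2y: "cat s2 y \<in> Y" using s12 y by (simp add: mem_wl cat_closed)
      have "(m, cat s y) \<in> X" using m s y by (simp add: mem_X mem_wl cat_closed)
      then have "(f \<otimes>\<^bsub>TM\<^esub> g) (m, cat s y) = g (f (m, cat s1 (cat s2 y)))"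
        by (simp add: mult_apply s12 cat_fcat)
      also have "\<dots> = g (fst e, cat t1 (cat t2 y))"
        using e(2)[OF s2y] t(3) by (simp add: dot_inf_eq flip: cat_fcat)
      also have "\<dots> = dot_inf n (fst e', fcat (snd e') t2) y"
        using e'(2)[OF cat_closed[OF t(2) y]] by (simp add: dot_inf_eq cat_fcat)
      finally show ?thesis .
    qed
    moreover have "(fst e', fcat (snd e') t2) \<in> nT n k r"
      using e' t by (simp add: mem_nT fcat_closed)
    ultimately show "\<exists>e\<in>nT n k r. \<forall>y\<in>Y. (f \<otimes>\<^bsub>TM\<^esub> g) (m, cat s y) = dot_inf n e y" by blast
  qed
  moreover have "f \<otimes>\<^bsub>TM\<^esub> g \<in> X \<rightarrow>\<^sub>E X"
  proof -
    have fg: "f \<in> X \<rightarrow> X" "g \<in> X \<rightarrow> X" using f g unfolding mem_carrier PiE_def by blast+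
    have "compose X g f \<in> X \<rightarrow>\<^sub>E X"
      unfolding PiE_def by (rule IntI[OF funcset_compose[OF fg] compose_extensional])
    then show ?thesis by (simp add: totM_def)
  qed
  ultimately show ?thesis by (auto simp: mem_carrier)
qed

definition shift_map :: "(nat \<Rightarrow> nat list) \<Rightarrow> nat \<times> (nat \<Rightarrow> nat stream) \<Rightarrow> nat \<times> (nat \<Rightarrow> nat stream)" where
  "shift_map s = (\<lambda>p\<in>X. (fst p, cat s (snd p)))"

definition copy_map :: "nat \<Rightarrow> nat \<times> (nat \<Rightarrow> nat stream) \<Rightarrow> nat \<times> (nat \<Rightarrow> nat stream)" where
  "copy_map j = (\<lambda>p\<in>X. (j, snd p))"

definition leaf_map :: "nat \<times> (nat \<Rightarrow> nat list) \<Rightarrow> nat \<times> (nat \<Rightarrow> nat stream) \<Rightarrow> nat \<times> (nat \<Rightarrow> nat stream)" where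
  "leaf_map d = (\<lambda>p\<in>X. dot_inf n d (snd p))"

lemma wl_W: "s \<in> wl N \<Longrightarrow> s \<in> W"
  by (simp add: mem_wl)

lemma map_apply:
  "m < r \<Longrightarrow> y \<in> Y \<Longrightarrow> shift_map s (m, y) = (m, cat s y)"
  "m < r \<Longrightarrow> y \<in> Y \<Longrightarrow> copy_map j (m, y) = (j, y)"
  "m < r \<Longrightarrow> y \<in> Y \<Longrightarrow> leaf_map d (m, y) = (fst d, cat (snd d) y)"
  by (simp_all add: shift_map_def copy_map_def leaf_map_def mem_X dot_inf_eq)

lemma carrierI:
  assumes "f \<in> extensional X"
    and "\<And>m s. m < r \<Longrightarrow> s \<in> wl N \<Longrightarrow> \<exists>e\<in>nT n k r. \<forall>y\<in>Y. f (m, cat s y) = dot_inf n e y"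
  shows "f \<in> carrier TM"
proof -
  have "f p \<in> X" if p: "p \<in> X" for p
  proof -
    have "\<exists>e\<in>nT n k r. \<forall>y\<in>Y. f (fst p, cat (head N (snd p)) y) = dot_inf n e y"
      using p by (intro assms(2)) (auto simp: mem_X head_wl)
    then obtain e where e: "e \<in> nT n k r"
      "\<forall>y\<in>Y. f (fst p, cat (head N (snd p)) y) = dot_inf n e y" by blast
    have y: "tail N (snd p) \<in> Y" using p by (simp add: mem_X tail_closed)
    then have "f p = dot_inf n e (tail N (snd p))"
      using e(2) cat_head_tail[of "snd p" N] p by (metis mem_X prod.collapse)
    then show ?thesis using e y by (simp add: dot_inf_eq mem_X mem_nT cat_closed)
  qed
  then show ?thesis
    using assms unfolding mem_carrier level_def PiE_def by blast
qed

lemma shift_map_carrier: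
  assumes t: "t \<in> W"
  shows "shift_map t \<in> carrier TM"
proof (rule carrierI[of _ 0])
  fix m s assume ms: "m < r" "s \<in> wl 0"
  have "\<forall>y\<in>Y. shift_map t (m, cat s y) = dot_inf n (m, fcat t s) y"
    using ms by (simp add: map_apply cat_closed mem_wl dot_inf_eq cat_fcat)
  moreover have "(m, fcat t s) \<in> nT n k r" using ms t by (simp add: mem_nT mem_wl fcat_closed)
  ultimately show "\<exists>e\<in>nT n k r. \<forall>y\<in>Y. shift_map t (m, cat s y) = dot_inf n e y" by blast
qed (simp add: shift_map_def)

lemma copy_map_carrier:
  assumes j: "j < r"
  shows "copy_map j \<in> carrier TM"
proof (rule carrierI[of _ 0])
  fix m s assume ms: "m < r" "s \<in> wl 0"
  have "\<forall>y\<in>Y. copy_map j (m, cat s y) = dot_inf n (j, s) y"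
    using ms by (simp add: map_apply cat_closed mem_wl dot_inf_eq)
  moreover have "(j, s) \<in> nT n k r" using ms j by (simp add: mem_nT mem_wl)
  ultimately show "\<exists>e\<in>nT n k r. \<forall>y\<in>Y. copy_map j (m, cat s y) = dot_inf n e y" by blast
qed (simp add: copy_map_def)

lemma leaf_map_carrier:
  assumes d: "d \<in> nT n k r"
  shows "leaf_map d \<in> carrier TM"
proof (rule carrierI[of _ 0])
  fix m s assume ms: "m < r" "s \<in> wl 0"
  have "\<forall>y\<in>Y. leaf_map d (m, cat s y) = dot_inf n (fst d, fcat (snd d) s) y"
    using ms by (simp add: map_apply cat_closed mem_wl dot_inf_eq cat_fcat)
  moreover have "(fst d, fcat (snd d) s) \<in> nT n k r"
    using ms d by (simp add: mem_nT mem_wl fcat_closed)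
  ultimately show "\<exists>e\<in>nT n k r. \<forall>y\<in>Y. leaf_map d (m, cat s y) = dot_inf n e y" by blast
qed (simp add: leaf_map_def)

lemma one_carrier: "\<one>\<^bsub>TM\<^esub> \<in> carrier TM"
proof (rule carrierI[of _ 0])
  fix m s assume ms: "m < r" "s \<in> wl 0"
  then have "\<forall>y\<in>Y. \<one>\<^bsub>TM\<^esub> (m, cat s y) = dot_inf n (m, s) y"
    by (simp add: one_apply mem_X cat_closed mem_wl dot_inf_eq)
  moreover have "(m, s) \<in> nT n k r" using ms by (simp add: mem_nT mem_wl)
  ultimately show "\<exists>e\<in>nT n k r. \<forall>y\<in>Y. \<one>\<^bsub>TM\<^esub> (m, cat s y) = dot_inf n e y" by blast
qed (simp add: totM_def)

sublocale monoid TM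
proof (rule monoidI)
  fix f g h assume "f \<in> carrier TM" "g \<in> carrier TM" "h \<in> carrier TM"
  then show "f \<otimes>\<^bsub>TM\<^esub> g \<otimes>\<^bsub>TM\<^esub> h = f \<otimes>\<^bsub>TM\<^esub> (g \<otimes>\<^bsub>TM\<^esub> h)"
    by (intro carrier_eqI mult_carrier) (auto simp: mult_apply carrier_apply)
next
  fix f assume f: "f \<in> carrier TM"
  then show "\<one>\<^bsub>TM\<^esub> \<otimes>\<^bsub>TM\<^esub> f = f" "f \<otimes>\<^bsub>TM\<^esub> \<one>\<^bsub>TM\<^esub> = f"
    by (auto intro!: carrier_eqI mult_carrier one_carrier simp: mult_apply one_apply carrier_apply)
qed (auto simp: mult_carrier one_carrier)

lemma map_eqI:
  assumes "f \<in> carrier TM" "g \<in> carrier TM" "\<And>m y. m < r \<Longrightarrow> y \<in> Y \<Longrightarrow> f (m, y) = g (m, y)"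
  shows "f = g"
  using assms by (intro carrier_eqI) (auto simp: mem_X)

lemma mult_apply': "m < r \<Longrightarrow> y \<in> Y \<Longrightarrow> (f \<otimes>\<^bsub>TM\<^esub> g) (m, y) = g (f (m, y))"
  by (simp add: mult_apply mem_X)

lemma shift_map_mult:
  "s \<in> W \<Longrightarrow> t \<in> W \<Longrightarrow> shift_map s \<otimes>\<^bsub>TM\<^esub> shift_map t = shift_map (fcat t s)"
  by (rule map_eqI)
    (auto simp: shift_map_carrier fcat_closed mult_apply' map_apply cat_closed cat_fcat)

lemma copy_map_mult:
  "j < r \<Longrightarrow> l < r \<Longrightarrow> copy_map j \<otimes>\<^bsub>TM\<^esub> copy_map l = copy_map l"
  by (rule map_eqI) (auto simp: copy_map_carrier mult_apply' map_apply)

lemma copy_map_shift_map: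
  "j < r \<Longrightarrow> s \<in> W \<Longrightarrow> copy_map j \<otimes>\<^bsub>TM\<^esub> shift_map s = leaf_map (j, s)"
  by (rule map_eqI)
    (auto simp: copy_map_carrier shift_map_carrier leaf_map_carrier mem_nT mult_apply' map_apply)

lemma shift_map_copy_map:
  "j < r \<Longrightarrow> s \<in> W \<Longrightarrow> shift_map s \<otimes>\<^bsub>TM\<^esub> copy_map j = leaf_map (j, s)"
  by (rule map_eqI)
    (auto simp: copy_map_carrier shift_map_carrier leaf_map_carrier mem_nT mult_apply' map_apply
      cat_closed)

lemma leaf_map_mult:
  assumes "d \<in> nT n k r" "e \<in> nT n k r"
  shows "leaf_map d \<otimes>\<^bsub>TM\<^esub> leaf_map e = leaf_map (fst e, fcat (snd e) (snd d))"
  using assms by - (rule map_eqI,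
    auto simp: leaf_map_carrier mem_nT mult_apply' map_apply cat_closed fcat_closed cat_fcat)

lemma leaf_map_inject:
  assumes d: "d \<in> nT n k r" and e: "e \<in> nT n k r" and eq: "leaf_map d = leaf_map e"
  shows "d = e"
proof -
  have *: "(fst d, cat (snd d) y) = (fst e, cat (snd e) y)" if "y \<in> Y" for y
    using fun_cong[OF eq, of "(0, y)"] that r by (simp add: map_apply)
  have "snd d = snd e" using d e * by (intro cat_inject) (auto simp: mem_nT)
  moreover have "fst d = fst e" using *[OF const_closed[of 0]] k by simp
  ultimately show ?thesis by (simp add: prod_eq_iff)
qed

section \<open>Normal forms of leaf maps\<close>

definition single :: "nat \<Rightarrow> nat list \<Rightarrow> nat \<Rightarrow> nat list" where
  "single i w = (\<lambda>j\<in>{..<n}. if j = i then w else [])"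

lemma single_W: "w \<in> lists {..<k} \<Longrightarrow> single i w \<in> W"
  by (auto simp: mem_W single_def)

definition letter :: "nat \<Rightarrow> nat \<Rightarrow> nat \<times> (nat \<Rightarrow> nat stream) \<Rightarrow> nat \<times> (nat \<Rightarrow> nat stream)" where
  "letter i a = shift_map (single i [a])"

lemma letter_carrier: "a < k \<Longrightarrow> letter i a \<in> carrier TM"
  unfolding letter_def by (intro shift_map_carrier single_W) auto

text \<open>The words are reversed because \<open>shift_map s \<otimes> shift_map t\<close> puts \<open>t\<close> in front of \<open>s\<close>.\<close>

definition block :: "(nat \<Rightarrow> nat list) \<Rightarrow> nat \<Rightarrow> (nat \<times> (nat \<Rightarrow> nat stream) \<Rightarrow> nat \<times> (nat \<Rightarrow> nat stream)) list" where
  "block s i = map (letter i) (rev (s i))"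

definition shift_word :: "(nat \<Rightarrow> nat list) \<Rightarrow> (nat \<times> (nat \<Rightarrow> nat stream) \<Rightarrow> nat \<times> (nat \<Rightarrow> nat stream)) list" where
  "shift_word s = concat (map (block s) [0..<n])"

definition canonical :: "nat \<times> (nat \<Rightarrow> nat list) \<Rightarrow> (nat \<times> (nat \<Rightarrow> nat stream) \<Rightarrow> nat \<times> (nat \<Rightarrow> nat stream)) list" where
  "canonical d = copy_map (fst d) # shift_word (snd d)"

definition gens :: "(nat \<times> (nat \<Rightarrow> nat stream) \<Rightarrow> nat \<times> (nat \<Rightarrow> nat stream)) set" where
  "gens = (\<lambda>(i, a). letter i a) ` ({..<n} \<times> {..<k}) \<union> copy_map ` {..<r}"

text \<open>Letters of the same coordinate satisfy no relation, which leaves one copy map followed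
  by a free block for each coordinate. In the last group the later copy map overwrites the copy
  index.\<close>

definition leaf_rels where
  "leaf_rels =
    (\<lambda>((i, a), (j, b)). ([letter i a, letter j b], [letter j b, letter i a])) `
      {((i, a), (j, b)). i < n \<and> a < k \<and> j < n \<and> b < k \<and> i \<noteq> j}
    \<union> (\<lambda>((i, a), j). ([letter i a, copy_map j], [copy_map j, letter i a])) `
      (({..<n} \<times> {..<k}) \<times> {..<r})
    \<union> (\<lambda>(j, l). ([copy_map j, copy_map l], [copy_map l])) ` ({..<r} \<times> {..<r})"

lemma finite_leaf_rels: "finite leaf_rels"
proof -
  have "finite {((i, a), (j, b)). i < n \<and> a < k \<and> j < n \<and> b < k \<and> i \<noteq> j}"
    by (rule finite_subset[of _ "({..<n} \<times> {..<k}) \<times> ({..<n} \<times> {..<k})"]) auto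
  then show ?thesis unfolding leaf_rels_def by simp
qed

lemma gens_carrier: "gens \<subseteq> carrier TM"
  by (auto simp: gens_def letter_carrier copy_map_carrier)

lemma leaf_rels_sound:
  assumes "(u, v) \<in> leaf_rels"
  shows "u \<in> lists gens \<and> v \<in> lists gens \<and> word_prod TM u = word_prod TM v"
proof -
  have "letter i a \<otimes>\<^bsub>TM\<^esub> letter j b = letter j b \<otimes>\<^bsub>TM\<^esub> letter i a"
    if "a < k" "b < k" "i \<noteq> j" for i j a b
  proof -
    have "fcat (single j [b]) (single i [a]) = fcat (single i [a]) (single j [b])"
      using that by (auto simp: fcat_def single_def)
    then show ?thesis using that by (simp add: letter_def shift_map_mult single_W)
  qed
  moreover have "letter i a \<otimes>\<^bsub>TM\<^esub> copy_map j = copy_map j \<otimes>\<^bsub>TM\<^esub> letter i a"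
    if "a < k" "j < r" for i a j
    using that by (simp add: letter_def shift_map_copy_map copy_map_shift_map single_W)
  ultimately show ?thesis
    using assms unfolding leaf_rels_def gens_def
    by (auto simp: letter_carrier copy_map_carrier copy_map_mult)
qed

lemma block_lists: "s \<in> W \<Longrightarrow> i < n \<Longrightarrow> block s i \<in> lists gens"
  by (auto simp: block_def mem_W gens_def in_lists_conv_set)

lemma shift_word_lists: "s \<in> W \<Longrightarrow> shift_word s \<in> lists gens"
  unfolding shift_word_def by (rule concat_in_lists) (auto simp: block_lists)

lemma canonical_lists: "d \<in> nT n k r \<Longrightarrow> canonical d \<in> lists gens"
  by (auto simp: canonical_def mem_nT shift_word_lists) (simp add: gens_def)

lemma lists_gens_carrier: "w \<in> lists gens \<Longrightarrow> w \<in> lists (carrier TM)"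
  using gens_carrier lists_mono by blast

lemma one_eq_shift_map: "\<one>\<^bsub>TM\<^esub> = shift_map (single 0 [])"
proof (rule map_eqI)
  fix m y assume my: "m < r" "y \<in> Y"
  have "cat (single 0 []) y = y"
    using my by (auto simp: cat_def single_def mem_Y extensional_def)
  then show "\<one>\<^bsub>TM\<^esub> (m, y) = shift_map (single 0 []) (m, y)"
    using my by (simp add: one_apply mem_X map_apply)
qed (auto simp: one_carrier intro!: shift_map_carrier single_W)

lemma word_prod_block:
  assumes "set w \<subseteq> {..<k}"
  shows "word_prod TM (map (letter i) (rev w)) = shift_map (single i w)"
  using assms
proof (induction w)
  case Nil
  have "single i [] = single 0 []" by (auto simp: single_def)
  then show ?case by (simp add: one_eq_shift_map)
next
  case (Cons a w)
  have "map (letter i) (rev w) \<in> lists (carrier TM)"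
    using Cons.prems by (auto simp: in_lists_conv_set letter_carrier)
  then have "word_prod TM (map (letter i) (rev (a # w))) =
      shift_map (single i w) \<otimes>\<^bsub>TM\<^esub> letter i a"
    using Cons by (simp add: word_prod_append letter_carrier)
  also have "\<dots> = shift_map (fcat (single i [a]) (single i w))"
    unfolding letter_def using Cons.prems
    by (intro shift_map_mult single_W) (auto simp: in_lists_conv_set)
  also have "fcat (single i [a]) (single i w) = single i (a # w)"
    by (auto simp: fcat_def single_def)
  finally show ?case .
qed

lemma word_prod_shift_word:
  assumes s: "s \<in> W"
  shows "word_prod TM (shift_word s) = shift_map s"
proof -
  \<comment> \<open>The tuple cut down to its first m coordinates, which is the value of the first m
    blocks.\<close>
  define t where "t m = (\<lambda>i\<in>{..<n}. if i < m then s i else [])" for m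
  have tW: "t m \<in> W" for m using s by (auto simp: t_def mem_W)
  have "word_prod TM (concat (map (block s) [0..<m])) = shift_map (t m)" if "m \<le> n" for m
    using that
  proof (induction m)
    case 0
    have "t 0 = single 0 []" by (auto simp: t_def single_def)
    then show ?case by (simp add: one_eq_shift_map)
  next
    case (Suc m)
    have m: "s m \<in> lists {..<k}" using s Suc.prems by (simp add: mem_W)
    have "concat (map (block s) [0..<m]) \<in> lists gens"
      using s Suc.prems by (intro concat_in_lists) (auto simp: block_lists)
    then have "word_prod TM (concat (map (block s) [0..<Suc m])) =
        shift_map (t m) \<otimes>\<^bsub>TM\<^esub> word_prod TM (block s m)"
      using Suc s block_lists[of s m] lists_gens_carrier by (simp add: word_prod_append)
    also have "word_prod TM (block s m) = shift_map (single m (s m))"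
      unfolding block_def using m by (intro word_prod_block) (auto simp: in_lists_conv_set)
    also have "shift_map (t m) \<otimes>\<^bsub>TM\<^esub> shift_map (single m (s m)) =
        shift_map (fcat (single m (s m)) (t m))"
      using tW m by (intro shift_map_mult single_W)
    also have "fcat (single m (s m)) (t m) = t (Suc m)"
      by (auto simp: t_def fcat_def single_def less_Suc_eq)
    finally show ?case .
  qed
  from this[of n] have "word_prod TM (shift_word s) = shift_map (t n)" by (simp add: shift_word_def)
  also have "t n = s" using s by (auto simp: t_def mem_W extensional_def)
  finally show ?thesis .
qed

lemma word_prod_canonical:
  "d \<in> nT n k r \<Longrightarrow> word_prod TM (canonical d) = leaf_map d"
  by (simp add: canonical_def word_prod_shift_word mem_nT copy_map_shift_map)

text \<open>The second copy map moves to the front and absorbs the first; then the blocks of equal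
  coordinates are brought together. Because \<open>block\<close> reverses words, the two blocks in
  this order form the block of the concatenation with \<open>snd e\<close> in front.\<close>

lemma canonical_append:
  assumes d: "d \<in> nT n k r" and e: "e \<in> nT n k r"
  shows "word_cong leaf_rels (canonical d @ canonical e)
    (canonical (fst e, fcat (snd e) (snd d)))"
proof -
  let ?C = "word_cong leaf_rels"
  let ?s = "shift_word (snd d)" and ?t = "shift_word (snd e)"
  let ?c = "copy_map (fst d)" and ?c' = "copy_map (fst e)"
  have letters: "\<exists>a<k. x = letter i a" if "x \<in> set (block s i)" "s \<in> W" "i < n" for x s i
    using that by (auto simp: block_def mem_W in_lists_conv_set)
  have 1: "?C (?s @ [?c']) ([?c'] @ ?s)"
  proof (rule word_cong_commute_lists)
    fix x y assume x: "x \<in> set ?s" and y: "y \<in> set [?c']"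
    from x obtain i where i: "i < n" "x \<in> set (block (snd d) i)" by (auto simp: shift_word_def)
    then obtain a where a: "a < k" "x = letter i a"
      using letters[OF i(2) _ i(1)] d by (auto simp: mem_nT)
    have "([letter i a, ?c'], [?c', letter i a]) \<in> leaf_rels"
      unfolding leaf_rels_def using i a e
      by (intro UnI1 UnI2 image_eqI[of _ _ "((i, a), fst e)"]) (auto simp: mem_nT)
    then show "?C ([x] @ [y]) ([y] @ [x])" using a y by (auto intro: word_cong.base)
  qed
  have 2: "?C ([?c, ?c']) [?c']"
    unfolding leaf_rels_def using d e
    by (intro word_cong.base UnI2 image_eqI[of _ _ "(fst d, fst e)"]) (auto simp: mem_nT)
  have block: "block (fcat (snd e) (snd d)) i = block (snd d) i @ block (snd e) i" if "i < n" for i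
    using that by (simp add: block_def fcat_def)
  have "?C (concat (map (\<lambda>i. block (snd d) i @ block (snd e) i) [0..<n])) (?s @ ?t)"
    unfolding shift_word_def
  proof (rule word_cong_concat_append)
    fix i j assume ij: "i \<in> set [0..<n]" "j \<in> set [0..<n]" "i \<noteq> j"
    show "?C (block (snd e) i @ block (snd d) j) (block (snd d) j @ block (snd e) i)"
    proof (rule word_cong_commute_lists)
      fix x y assume "x \<in> set (block (snd e) i)" "y \<in> set (block (snd d) j)"
      then obtain a b where ab: "a < k" "x = letter i a" "b < k" "y = letter j b"
        using letters[of x "snd e" i] letters[of y "snd d" j] d e ij by (auto simp: mem_nT)
      have "([letter i a, letter j b], [letter j b, letter i a]) \<in> leaf_rels"
        unfolding leaf_rels_def using ab ij
        by (intro UnI1 image_eqI[of _ _ "((i, a), (j, b))"]) auto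
      then show "?C ([x] @ [y]) ([y] @ [x])" using ab by (auto intro: word_cong.base)
    qed
  qed simp
  also have "concat (map (\<lambda>i. block (snd d) i @ block (snd e) i) [0..<n]) =
      shift_word (fcat (snd e) (snd d))"
    unfolding shift_word_def using block by (intro arg_cong[of _ _ concat] map_cong) auto
  finally have 3: "?C (?s @ ?t) (shift_word (fcat (snd e) (snd d)))" by (rule word_cong.sym)
  have "?C (canonical d @ canonical e) ([?c, ?c'] @ (?s @ ?t))"
    using word_cong_mid[OF 1, of "[?c]" ?t] by (simp add: canonical_def)
  then have "?C (canonical d @ canonical e) ([?c'] @ shift_word (fcat (snd e) (snd d)))"
    using word_cong.append[OF 2 3] by (rule word_cong.trans)
  then show ?thesis by (simp add: canonical_def)
qed

section \<open>Joins over uniform cones, and the choice of the linking maps\<close>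

lemma finite_wl: "finite (wl N)"
  unfolding wl_def by (intro finite_PiE finite_lists_length_eq) auto

lemma card_wl: "card (wl N) = (k ^ N) ^ n"
proof -
  have "card (wl N) = card {s. set s \<subseteq> {..<k} \<and> length s = N} ^ n"
    unfolding wl_def by (simp add: card_PiE)
  then show ?thesis using card_lists_length_eq[of "{..<k}" N] by simp
qed

text \<open>h reads the first N letters of every coordinate, which name a piece, and applies the
  corresponding f to the rest, with the copy index kept. It is unique because every point starts
  with the label of a piece.\<close>

lemma ex1_join:
  fixes K :: nat
  assumes e: "bij_betw e {..<K} (wl N)" and f: "\<And>a. a < K \<Longrightarrow> f a \<in> carrier TM"
  shows "\<exists>!h. h \<in> carrier TM \<and> (\<forall>a<K. shift_map (e a) \<otimes>\<^bsub>TM\<^esub> h = f a)"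
proof -
  define e' where "e' = inv_into {..<K} e"
  have e'e: "e' (e a) = a" if "a < K" for a
    unfolding e'_def using e that by (simp add: bij_betw_def)
  have ee': "e' s < K" "e (e' s) = s" if "s \<in> wl N" for s
    using bij_betw_inv_into_right[OF e that] bij_betw_apply[OF bij_betw_inv_into[OF e] that]
    unfolding e'_def by auto
  have eW: "e a \<in> wl N" if "a < K" for a using bij_betw_apply[OF e, of a] that by simp
  define h where "h = (\<lambda>p\<in>X. f (e' (head N (snd p))) (fst p, tail N (snd p)))"
  have h_apply: "h (m, cat s y) = f (e' s) (m, y)" if "m < r" "s \<in> wl N" "y \<in> Y" for m s y
    using that by (simp add: h_def mem_X cat_closed mem_wl[of s] head_cat tail_cat)
  have "\<forall>a<K. \<exists>L. level L (f a)" using f by (auto simp: mem_carrier)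
  then obtain L where L: "\<And>a. a < K \<Longrightarrow> level (L a) (f a)" by metis
  \<comment> \<open>The sum serves as a common upper bound of the levels.\<close>
  define L' where "L' = (\<Sum>a<K. L a)"
  have L': "level L' (f a)" if "a < K" for a
    using that unfolding L'_def by (intro level_mono[OF L] member_le_sum) auto
  have "h \<in> carrier TM"
  proof (rule carrierI[of _ "N + L'"])
    fix m s assume m: "m < r" and s: "s \<in> wl (N + L')"
    obtain s1 s2 where s12: "s1 \<in> wl N" "s2 \<in> wl L'" "s = fcat s1 s2" by (rule split_wl[OF s])
    obtain d where d: "d \<in> nT n k r" "\<And>y. y \<in> Y \<Longrightarrow> f (e' s1) (m, cat s2 y) = dot_inf n d y"
      using L'[OF ee'(1)[OF s12(1)]] m s12 unfolding level_def by blast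
    have "h (m, cat s y) = dot_inf n d y" if "y \<in> Y" for y
      using h_apply[OF m s12(1) cat_closed[OF wl_W[OF s12(2)] that]] d(2)[OF that] s12
      by (simp add: cat_fcat)
    then show "\<exists>e\<in>nT n k r. \<forall>y\<in>Y. h (m, cat s y) = dot_inf n e y" using d by blast
  qed (simp add: h_def)
  moreover have "shift_map (e a) \<otimes>\<^bsub>TM\<^esub> h = f a" if a: "a < K" for a
    using \<open>h \<in> carrier TM\<close> f[OF a] eW[OF a] a
    by (intro map_eqI mult_carrier shift_map_carrier)
      (auto simp: mult_apply' map_apply h_apply e'e mem_wl)
  moreover have "h' = h" if h': "h' \<in> carrier TM" "\<forall>a<K. shift_map (e a) \<otimes>\<^bsub>TM\<^esub> h' = f a" for h'
  proof (rule map_eqI)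
    fix m y assume my: "m < r" "y \<in> Y"
    let ?s = "head N y" and ?y = "tail N y"
    have s: "?s \<in> wl N" "?y \<in> Y" using my by (auto simp: head_wl tail_closed)
    have "h' (m, y) = h' (m, cat ?s ?y)" using my by (simp add: cat_head_tail)
    also have "\<dots> = (shift_map (e (e' ?s)) \<otimes>\<^bsub>TM\<^esub> h') (m, ?y)"
      using my s ee' by (simp add: mult_apply' map_apply)
    also have "\<dots> = f (e' ?s) (m, ?y)" using h'(2) ee'(1)[OF s(1)] by simp
    also have "\<dots> = h (m, y)" using h_apply[OF my(1) s] my by (simp add: cat_head_tail)
    finally show "h' (m, y) = h (m, y)" .
  qed (use h' \<open>h \<in> carrier TM\<close> in auto)
  ultimately show ?thesis by blast
qed

text \<open>Prefix lengths add up along the product. At least one factor is required: the empty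
  product is the identity, which is no leaf map when r > 1.\<close>

lemma words_pow_canonical:
  "v \<in> words_pow (canonical ` ({..<r} \<times> wl 1)) (Suc m) \<Longrightarrow>
    v \<in> lists gens \<and> (\<exists>d\<in>{..<r} \<times> wl (Suc m). word_prod TM v = leaf_map d)"
proof (induction m arbitrary: v)
  case 0
  then obtain d where d: "d \<in> {..<r} \<times> wl 1" "v = canonical d" by auto
  then have "d \<in> nT n k r" by (auto simp: mem_nT mem_wl)
  then show ?case using d canonical_lists word_prod_canonical by auto
next
  case (Suc m)
  let ?B = "canonical ` ({..<r} \<times> wl 1)"
  obtain b v' where b: "v = b @ v'" "b \<in> ?B" "v' \<in> words_pow ?B (Suc m)"
    using Suc.prems by (rule words_pow_SucE)
  then obtain d where d: "d \<in> {..<r} \<times> wl 1" "v = canonical d @ v'"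
    "v' \<in> words_pow ?B (Suc m)"
    by (elim imageE) simp
  then obtain e where e: "e \<in> {..<r} \<times> wl (Suc m)" "word_prod TM v' = leaf_map e"
    and v': "v' \<in> lists gens" using Suc.IH by blast
  have nT: "d \<in> nT n k r" "e \<in> nT n k r" using d e by (auto simp: mem_nT mem_wl)
  have "word_prod TM v = leaf_map (fst e, fcat (snd e) (snd d))"
    using d(2) e(2) nT v' lists_gens_carrier canonical_lists
    by (simp add: word_prod_append word_prod_canonical leaf_map_mult)
  moreover have "(fst e, fcat (snd e) (snd d)) \<in> {..<r} \<times> wl (Suc (Suc m))"
    using d e fcat_wl[of "snd e" "Suc m" "snd d" 1] by auto
  ultimately show ?case using d(2) v' canonical_lists[OF nT(1)] by auto
qed

lemma finitely_presented_totM: "finitely_presented_monoid TM"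
proof -
  \<comment> \<open>There are then \<open>(k ^ r) ^ n * k ^ n\<close> pieces. The first factor is at
    least r, so the \<open>r * k ^ n\<close> cones of depth 1 can be labelled by distinct
    pieces.\<close>
  define N where "N = r + 1"
  define K where "K = card (wl N)"
  obtain e where e: "bij_betw e {..<K} (wl N)"
    using ex_bij_betw_nat_finite[OF finite_wl] unfolding K_def by (metis lessThan_atLeast0)
  have eW: "e a \<in> wl N" if "a < K" for a using bij_betw_apply[OF e, of a] that by simp
  let ?L = "{..<r} \<times> wl 1"
  have L: "?L \<subseteq> nT n k r" by (auto simp: mem_nT mem_wl)
  have kr: "r \<le> (k ^ r) ^ n"
  proof -
    have "r \<le> 2 ^ r" by (simp add: less_imp_le)
    also have "\<dots> \<le> k ^ r" using k by (intro power_mono) auto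
    also have "\<dots> \<le> (k ^ r) ^ n" using n k by (intro self_le_power) auto
    finally show ?thesis .
  qed
  have "2 \<le> k ^ n" using k n self_le_power[of k n] by linarith
  have Kk: "K = (k ^ r) ^ n * k ^ n" by (simp add: K_def card_wl N_def power_mult_distrib)
  have "card ?L \<le> K"
    using kr by (simp add: Kk card_cartesian_product card_wl)
  then obtain \<iota> where \<iota>: "inj_on \<iota> ?L" "\<iota> ` ?L \<subseteq> wl N"
    using inj_on_iff_card_le[of ?L "wl N"] finite_wl unfolding K_def by auto
  \<comment> \<open>Pieces that label no cone of depth 1 get a fixed one, since \<alpha> a followed
    by \<theta> has to be the value of a word of B for every a.\<close>
  define d0 where "d0 s = (if s \<in> \<iota> ` ?L then inv_into ?L \<iota> s else (0, head 1 (const 0)))" for s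
  have d0: "d0 s \<in> ?L" for s
    using r k head_wl[OF const_closed[of 0]] inv_into_into[of s \<iota> ?L] unfolding d0_def by auto
  have d0_\<iota>: "d0 (\<iota> d) = d" if "d \<in> ?L" for d
    using that \<iota>(1) unfolding d0_def by auto
  \<comment> \<open>\<theta>' writes the copy index and the first letters into the label of a piece;
    \<theta> reads the label, forgets the current copy and restores both.\<close>
  define \<theta> where "\<theta> = (\<lambda>p\<in>X. dot_inf n (d0 (head N (snd p))) (tail N (snd p)))"
  define \<theta>' where "\<theta>' = (\<lambda>p\<in>X. (fst p, cat (\<iota> (fst p, head 1 (snd p))) (tail 1 (snd p))))"
  have \<theta>_apply: "\<theta> (m, cat s y) = dot_inf n (d0 s) y" if "m < r" "s \<in> wl N" "y \<in> Y" for m s y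
    using that by (simp add: \<theta>_def mem_X cat_closed wl_W head_cat tail_cat)
  have \<theta>'_apply: "\<theta>' (m, cat s y) = (m, cat (\<iota> (m, s)) y)"
    if "m < r" "s \<in> wl 1" "y \<in> Y" for m s y
    using that by (simp add: \<theta>'_def mem_X cat_closed wl_W head_cat tail_cat)
  have \<iota>_wl: "\<iota> (m, s) \<in> wl N" if "m < r" "s \<in> wl 1" for m s using \<iota>(2) that by blast
  have \<theta>_carrier: "\<theta> \<in> carrier TM"
  proof (rule carrierI[of _ N])
    fix m s assume "m < r" "s \<in> wl N"
    then have "\<forall>y\<in>Y. \<theta> (m, cat s y) = dot_inf n (d0 s) y" using \<theta>_apply by simp
    then show "\<exists>e\<in>nT n k r. \<forall>y\<in>Y. \<theta> (m, cat s y) = dot_inf n e y"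
      using subsetD[OF L d0] by (rule bexI)
  qed (simp add: \<theta>_def)
  have \<theta>'_carrier: "\<theta>' \<in> carrier TM"
  proof (rule carrierI[of _ 1])
    fix m s assume ms: "m < r" "s \<in> wl 1"
    then have "\<forall>y\<in>Y. \<theta>' (m, cat s y) = dot_inf n (m, \<iota> (m, s)) y"
      by (simp add: \<theta>'_apply dot_inf_eq)
    moreover have "(m, \<iota> (m, s)) \<in> nT n k r" using ms wl_W[OF \<iota>_wl] by (simp add: mem_nT)
    ultimately show "\<exists>e\<in>nT n k r. \<forall>y\<in>Y. \<theta>' (m, cat s y) = dot_inf n e y" by blast
  qed (simp add: \<theta>'_def)
  interpret leaf_monoid TM K "\<lambda>a. shift_map (e a)" gens leaf_rels "canonical ` nT n k r"
    "canonical ` ?L" \<theta> \<theta>'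
  proof (unfold_locales, goal_cases)
    case 1
    have "K \<ge> 1 * 2" unfolding Kk using kr r \<open>2 \<le> k ^ n\<close> by (intro mult_le_mono) auto
    then show ?case by simp
  next
    case (2 a)
    then show ?case using eW by (intro shift_map_carrier wl_W)
  next
    case (3 f)
    then show ?case by (rule ex1_join[OF e])
  next
    case 4
    show ?case by (simp add: gens_def)
  next
    case 5
    show ?case by (rule gens_carrier)
  next
    case 6
    show ?case by (rule finite_leaf_rels)
  next
    case 7
    show ?case using leaf_rels_sound by auto
  next
    case (8 u v)
    then show ?case using leaf_rels_sound by blast
  next
    case 9
    show ?case using canonical_lists by auto
  next
    case 10
    show ?case
      by (rule inj_onI) (auto simp del: split_paired_All simp: word_prod_canonical dest: leaf_map_inject)
  next
    case (11 u v)
    then obtain d d' where "d \<in> nT n k r" "d' \<in> nT n k r" "u = canonical d" "v = canonical d'"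
      by blast
    moreover then have "(fst d', fcat (snd d') (snd d)) \<in> nT n k r" by (simp add: mem_nT fcat_closed)
    ultimately show ?case using canonical_append by blast
  next
    case 12
    show ?case by (simp add: finite_wl)
  next
    case 13
    show ?case using L by auto
  next
    case (14 b u)
    then obtain d d' where d: "d \<in> ?L" "b = canonical d" "d' \<in> nT n k r" "u = canonical d'"
      by blast
    then have dn: "d \<in> nT n k r" using L by blast
    have W: "fcat (snd d') (snd d) \<in> W" using d dn by (simp add: mem_nT fcat_closed)
    have len: "1 \<le> length (fcat (snd d') (snd d) i)" if "i < n" for i
      using d that by (auto simp: mem_wl fcat_def)
    obtain s t where st: "s \<in> wl 1" "t \<in> W" "fcat (snd d') (snd d) = fcat s t"
      by (rule split_word[OF W len]) blast+
    \<comment> \<open>The copy index 0 is a dummy that the copy map of \<open>?b\<close>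
      overwrites.\<close>
    let ?l = "(0, t)" and ?b = "(fst d', s)"
    have l: "?l \<in> nT n k r" "?b \<in> ?L" using st d r by (auto simp: mem_nT)
    then have bn: "?b \<in> nT n k r" using L by blast
    have "word_prod TM (b @ u) = word_prod TM (canonical ?l @ canonical ?b)"
      using d dn l(1) bn canonical_lists lists_gens_carrier st(3)
      by (simp add: word_prod_append word_prod_canonical leaf_map_mult)
    then show ?case using l by blast
  next
    case (15 f)
    then obtain N' where "level N' f" by (auto simp: mem_carrier)
    \<comment> \<open>Raised by one because the prefixes have \<open>Suc N'\<close> factors and are
      therefore leaf maps of that depth.\<close>
    then have lev: "level (Suc N') f" by (rule level_mono) simp
    have "word_prod TM v \<otimes>\<^bsub>TM\<^esub> f \<in> word_prod TM ` canonical ` nT n k r"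
      if v: "v \<in> words_pow (canonical ` ?L) (Suc N')" for v
    proof -
      obtain d where d: "d \<in> {..<r} \<times> wl (Suc N')" "word_prod TM v = leaf_map d"
        using words_pow_canonical[OF v] by blast
      then have d': "fst d < r" "snd d \<in> wl (Suc N')" "d \<in> nT n k r" by (auto simp: mem_nT mem_wl)
      then obtain c where c: "c \<in> nT n k r" "\<And>y. y \<in> Y \<Longrightarrow> f (fst d, cat (snd d) y) = dot_inf n c y"
        using lev unfolding level_def by blast
      have "leaf_map d \<otimes>\<^bsub>TM\<^esub> f = leaf_map c"
        using d' c 15 by - (rule map_eqI, auto simp: mult_carrier leaf_map_carrier mult_apply'
          map_apply dot_inf_eq)
      then show ?thesis using d c by (auto simp: word_prod_canonical[symmetric])
    qed
    then show ?case by blast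
  next
    case 16
    show ?case by (rule \<theta>_carrier)
  next
    case 17
    show ?case by (rule \<theta>'_carrier)
  next
    case 18
    show ?case
    proof (rule map_eqI)
      fix m y assume my: "m < r" "y \<in> Y"
      let ?s = "head 1 y" and ?y = "tail 1 y"
      have s: "?s \<in> wl 1" "?y \<in> Y" using my by (auto simp: head_wl tail_closed)
      have "\<theta>' (m, y) = (m, cat (\<iota> (m, ?s)) ?y)"
        using \<theta>'_apply[OF my(1) s] my by (simp add: cat_head_tail)
      then have "(\<theta>' \<otimes>\<^bsub>TM\<^esub> \<theta>) (m, y) = dot_inf n (m, ?s) ?y"
        using my s \<theta>_apply[OF my(1) \<iota>_wl s(2)] d0_\<iota>[of "(m, ?s)"] by (simp add: mult_apply')
      then show "(\<theta>' \<otimes>\<^bsub>TM\<^esub> \<theta>) (m, y) = \<one>\<^bsub>TM\<^esub> (m, y)"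
        using my by (simp add: dot_inf_eq one_apply mem_X cat_head_tail)
    qed (auto simp: mult_carrier \<theta>_carrier \<theta>'_carrier one_carrier)
  next
    case (19 a)
    have "shift_map (e a) \<otimes>\<^bsub>TM\<^esub> \<theta> = leaf_map (d0 (e a))"
      using eW[OF 19] \<theta>_carrier d0[of "e a"] L
      by - (rule map_eqI, auto simp: mult_carrier shift_map_carrier wl_W leaf_map_carrier subset_iff
        mult_apply' map_apply \<theta>_apply dot_inf_eq)
    also have "\<dots> = word_prod TM (canonical (d0 (e a)))"
      using word_prod_canonical[OF subsetD[OF L d0]] by simp
    finally show ?case using imageI[OF d0] by (rule bexI)
  qed
  show ?thesis by (rule finitely_presented)
qed

end

theorem theorem1p2:
  fixes r n k :: nat
  assumes "r \<ge> 1" and "n \<ge> 1" and "k \<ge> 2"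
  shows "finitely_presented_monoid (totM n k r)"
proof -
  interpret tot_monoid n k r by unfold_locales (use assms in auto)
  show ?thesis by (rule finitely_presented_totM)
qed

end
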